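(* Let $\mathcal{I}$ be the species of interval orders, and let $E^{-1}$ be the multiplicative inverse of the species $E$ of sets in the ring $\mathrm{Virt}$ of virtual species. Then, in $\mathrm{Virt}$, $$\mathcal{I} \;=\; \sum_{m\geq 0}(-1)^m\prod_{i=1}^{m}\bigl((E^{-1})^i-1\bigr).$$
   Context: A species is a functor $F$ from the category of finite sets and bijections to the category of finite sets and functions; for a bijection $\sigma\colon U\to V$ the map $F[\sigma]\colon F[U]\to F[V]$ is called transport, written $s\mapsto\sigma\cdot s$. Equality $F=G$ of species means natural isomorphism. Sum: $(F+G)[U]=F[U]\sqcup G[U]$; product: $(FG)[U]=\bigsqcup_{U=U_1\sqcup U_2}F[U_1]\times G[U_2]$. The species $1$ has one structure on $\emptyset$ and none elsewhere; $E$ is the species of sets, with exactly one structure on every finite set; $E_+$ is its restriction to nonempty sets. Virtual species: $\mathrm{Virt}=(\mathrm{Spe}\times\mathrm{Spe})/\!\sim$, where $\mathrm{Spe}$ is the semiring of species up to isomorphism and $(F,G)\sim(H,K)$ iff $F+K=G+H$ as species; the class of $(F,G)$ is written $F-G$. This is a commutative ring into which $\mathrm{Spe}$ embeds by $F\mapsto F-0$. Infinite sums are taken in the summable sense: on each finite set only finitely many summands contribute. The inverse of $E$ is $E^{-1}=\sum_{k\geq0}(-1)^kE_+^k$. The empty product (for $m=0$) is $1$. Interval orders: a poset on a finite set $U$ is an irreflexive transitive relation $<$ on $U$. It is $(2{+}2)$-free (equivalently, an interval order) if it has no induced subposet isomorphic to the disjoint union of two two-element chains. $\mathcal{I}[U]$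 is the set of $(2{+}2)$-free posets on $U$ (viewed as sets of ordered pairs), with transport $\sigma\cdot P=\{(\sigma x,\sigma y):(x,y)\in P\}$. *)

theory Defs
  imports Main "HOL-Library.Countable_Set"
begin

section \<open>Species\<close>

text \<open>
  A species with labels in \<open>'a\<close> and structures in \<open>'s\<close> is given by the sets \<open>S U\<close> of structures
  and the transports \<open>T U \<sigma> : S U \<rightarrow> S V\<close> along bijections \<open>\<sigma> : U \<rightarrow> V\<close> between finite subsets
  of \<open>'a\<close>.  HOL functions being total, a morphism \<open>U \<rightarrow> V\<close> is the restriction to \<open>U\<close>
  of some \<open>\<sigma>\<close> with \<open>bij_betw \<sigma> U V\<close>; the third clause says that \<open>T U \<sigma>\<close> depends only
  on this restriction.  The last two clauses are the functor laws.  Nothing is required on infinite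
  sets of labels.  When \<open>'a\<close> is infinite, the finite subsets of \<open>'a\<close> with their bijections form
  a category equivalent to that of all finite sets.
\<close>

definition species_functor :: "('a set \<Rightarrow> 's set) \<Rightarrow> ('a set \<Rightarrow> ('a \<Rightarrow> 'a) \<Rightarrow> 's \<Rightarrow> 's) \<Rightarrow> bool" where
  "species_functor S T \<longleftrightarrow>
     (\<forall>U. finite U \<longrightarrow> finite (S U)) \<and>
     (\<forall>U V \<sigma>. finite U \<longrightarrow> bij_betw \<sigma> U V \<longrightarrow> T U \<sigma> ` S U \<subseteq> S V) \<and>
     (\<forall>U V \<sigma> \<sigma>'. finite U \<longrightarrow> bij_betw \<sigma> U V \<longrightarrow> (\<forall>x\<in>U. \<sigma> x = \<sigma>' x) \<longrightarrow>
        (\<forall>s\<in>S U. T U \<sigma> s = T U \<sigma>' s)) \<and>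
     (\<forall>U. finite U \<longrightarrow> (\<forall>s\<in>S U. T U id s = s)) \<and>
     (\<forall>U V W \<sigma> \<tau>. finite U \<longrightarrow> bij_betw \<sigma> U V \<longrightarrow> bij_betw \<tau> V W \<longrightarrow>
        (\<forall>s\<in>S U. T U (\<tau> \<circ> \<sigma>) s = T V \<tau> (T U \<sigma> s)))"

lemma species_functorI:
  assumes "\<And>U. finite U \<Longrightarrow> finite (S U)"
    and "\<And>U V \<sigma> s. finite U \<Longrightarrow> bij_betw \<sigma> U V \<Longrightarrow> s \<in> S U \<Longrightarrow> T U \<sigma> s \<in> S V"
    and "\<And>U V \<sigma> \<sigma>' s. finite U \<Longrightarrow> bij_betw \<sigma> U V \<Longrightarrow> (\<And>x. x \<in> U \<Longrightarrow> \<sigma> x = \<sigma>' x) \<Longrightarrow> s \<in> S U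
           \<Longrightarrow> T U \<sigma> s = T U \<sigma>' s"
    and "\<And>U s. finite U \<Longrightarrow> s \<in> S U \<Longrightarrow> T U id s = s"
    and "\<And>U V W \<sigma> \<tau> s. finite U \<Longrightarrow> bij_betw \<sigma> U V \<Longrightarrow> bij_betw \<tau> V W \<Longrightarrow> s \<in> S U
           \<Longrightarrow> T U (\<tau> \<circ> \<sigma>) s = T V \<tau> (T U \<sigma> s)"
  shows "species_functor S T"
  unfolding species_functor_def
  apply (intro conjI allI impI ballI image_subsetI)
  subgoal using assms(1) .
  subgoal using assms(2) by blast
  subgoal using assms(3) by blast
  subgoal using assms(4) by blast
  subgoal using assms(5) by blast
  done

typedef ('a, 's) species =
  "{(S :: 'a set \<Rightarrow> 's set, T :: 'a set \<Rightarrow> ('a \<Rightarrow> 'a) \<Rightarrow> 's \<Rightarrow> 's). species_functor S T}"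
  by (rule exI[of _ "(\<lambda>_. {}, \<lambda>_ _ s. s)"]) (simp add: species_functor_def)

definition mk_species ::
  "('a set \<Rightarrow> 's set) \<Rightarrow> ('a set \<Rightarrow> ('a \<Rightarrow> 'a) \<Rightarrow> 's \<Rightarrow> 's) \<Rightarrow> ('a, 's) species" where
  "mk_species S T = Abs_species (S, T)"

definition structs :: "('a, 's) species \<Rightarrow> 'a set \<Rightarrow> 's set" where
  "structs F = fst (Rep_species F)"

definition transport :: "('a, 's) species \<Rightarrow> 'a set \<Rightarrow> ('a \<Rightarrow> 'a) \<Rightarrow> 's \<Rightarrow> 's" where
  "transport F = snd (Rep_species F)"

lemma mk_species:
  assumes "species_functor S T"
  shows "structs (mk_species S T) = S" "transport (mk_species S T) = T"
  using assms by (simp_all add: mk_species_def structs_def transport_def Abs_species_inverse)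

lemma species_functor: "species_functor (structs F) (transport F)"
  using Rep_species[of F] by (auto simp: structs_def transport_def)

lemma finite_structs: "finite U \<Longrightarrow> finite (structs F U)"
  using species_functor[of F] by (simp add: species_functor_def)

lemma transport_in: "finite U \<Longrightarrow> bij_betw \<sigma> U V \<Longrightarrow> s \<in> structs F U \<Longrightarrow> transport F U \<sigma> s \<in> structs F V"
  using species_functor[of F] by (simp add: species_functor_def image_subset_iff)

lemma transport_cong:
  assumes "finite U" "bij_betw \<sigma> U V" "\<And>x. x \<in> U \<Longrightarrow> \<sigma> x = \<sigma>' x" "s \<in> structs F U"
  shows "transport F U \<sigma> s = transport F U \<sigma>' s"
  using species_functor[of F, unfolded species_functor_def, THEN conjunct2, THEN conjunct2, THEN conjunct1,
      rule_format, OF assms(1,2) _ assms(4)] assms(3) by simp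

lemma transport_id: "finite U \<Longrightarrow> s \<in> structs F U \<Longrightarrow> transport F U id s = s"
  using species_functor[of F] by (simp add: species_functor_def)

lemma transport_comp:
  "finite U \<Longrightarrow> bij_betw \<sigma> U V \<Longrightarrow> bij_betw \<tau> V W \<Longrightarrow> s \<in> structs F U \<Longrightarrow>
   transport F U (\<tau> \<circ> \<sigma>) s = transport F V \<tau> (transport F U \<sigma> s)"
  using species_functor[of F, unfolded species_functor_def, THEN conjunct2, THEN conjunct2, THEN conjunct2,
      THEN conjunct2, rule_format, of U \<sigma> V \<tau> W s] by simp

definition species_iso :: "('a, 's) species \<Rightarrow> ('a, 't) species \<Rightarrow> bool" where
  "species_iso F G \<longleftrightarrow> (\<exists>\<phi>.
     (\<forall>U. finite U \<longrightarrow> bij_betw (\<phi> U) (structs F U) (structs G U)) \<and>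
     (\<forall>U V \<sigma>. finite U \<longrightarrow> bij_betw \<sigma> U V \<longrightarrow>
        (\<forall>s\<in>structs F U. \<phi> V (transport F U \<sigma> s) = transport G U \<sigma> (\<phi> U s))))"

lemma species_isoI:
  assumes "\<And>U. finite U \<Longrightarrow> bij_betw (\<phi> U) (structs F U) (structs G U)"
    and "\<And>U V \<sigma> s. finite U \<Longrightarrow> finite V \<Longrightarrow> bij_betw \<sigma> U V \<Longrightarrow> s \<in> structs F U \<Longrightarrow>
           \<phi> V (transport F U \<sigma> s) = transport G U \<sigma> (\<phi> U s)"
  shows "species_iso F G"
  unfolding species_iso_def using assms by (metis bij_betw_finite)

lemma species_isoE:
  assumes "species_iso F G"
  obtains \<phi> where "\<And>U. finite U \<Longrightarrow> bij_betw (\<phi> U) (structs F U) (structs G U)"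
    and "\<And>U V \<sigma> s. finite U \<Longrightarrow> bij_betw \<sigma> U V \<Longrightarrow> s \<in> structs F U \<Longrightarrow>
           \<phi> V (transport F U \<sigma> s) = transport G U \<sigma> (\<phi> U s)"
proof -
  obtain \<phi> where
    *: "\<forall>U. finite U \<longrightarrow> bij_betw (\<phi> U) (structs F U) (structs G U)"
    and **: "\<forall>U V \<sigma>. finite U \<longrightarrow> bij_betw \<sigma> U V \<longrightarrow>
        (\<forall>s\<in>structs F U. \<phi> V (transport F U \<sigma> s) = transport G U \<sigma> (\<phi> U s))"
    using assms unfolding species_iso_def by (elim exE conjE)
  show thesis
    by (rule that[OF *[rule_format] **[rule_format]])
qed

lemma species_iso_refl: "species_iso F F"
  by (rule species_isoI[of "\<lambda>_ s. s"]) (simp_all add: bij_betw_def)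

lemma species_iso_sym:
  assumes "species_iso F G" shows "species_iso G F"
proof -
  obtain \<phi> where b: "\<And>U. finite U \<Longrightarrow> bij_betw (\<phi> U) (structs F U) (structs G U)"
    and n: "\<And>U V \<sigma> s. finite U \<Longrightarrow> bij_betw \<sigma> U V \<Longrightarrow> s \<in> structs F U \<Longrightarrow>
           \<phi> V (transport F U \<sigma> s) = transport G U \<sigma> (\<phi> U s)"
    by (rule species_isoE[OF assms], rule that)
  show ?thesis
  proof (rule species_isoI[of "\<lambda>U. inv_into (structs F U) (\<phi> U)"])
    fix U V :: "'a set" and \<sigma> t assume U: "finite U" "finite V" and \<sigma>: "bij_betw \<sigma> U V" and t: "t \<in> structs G U"
    obtain s where s: "s \<in> structs F U" "t = \<phi> U s"
      using b[OF U(1)] t by (auto simp: bij_betw_def)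
    have "inv_into (structs F V) (\<phi> V) (transport G U \<sigma> t) =
          inv_into (structs F V) (\<phi> V) (\<phi> V (transport F U \<sigma> s))"
      using n[OF U(1) \<sigma> s(1)] s(2) by simp
    also have "\<dots> = transport F U \<sigma> s"
      using bij_betw_inv_into_left[OF b[OF U(2)]] transport_in[OF U(1) \<sigma> s(1)] by simp
    also have "s = inv_into (structs F U) (\<phi> U) t"
      using bij_betw_inv_into_left[OF b[OF U(1)]] s by simp
    finally show "inv_into (structs F V) (\<phi> V) (transport G U \<sigma> t) =
       transport F U \<sigma> (inv_into (structs F U) (\<phi> U) t)" .
  qed (use b bij_betw_inv_into in blast)
qed

lemma species_iso_trans:
  assumes "species_iso F G" "species_iso G H" shows "species_iso F H"
proof -
  obtain \<phi> where b: "\<And>U. finite U \<Longrightarrow> bij_betw (\<phi> U) (structs F U) (structs G U)"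
    and n: "\<And>U V \<sigma> s. finite U \<Longrightarrow> bij_betw \<sigma> U V \<Longrightarrow> s \<in> structs F U \<Longrightarrow>
           \<phi> V (transport F U \<sigma> s) = transport G U \<sigma> (\<phi> U s)"
    by (rule species_isoE[OF assms(1)], rule that)
  obtain \<psi> where b': "\<And>U. finite U \<Longrightarrow> bij_betw (\<psi> U) (structs G U) (structs H U)"
    and n': "\<And>U V \<sigma> s. finite U \<Longrightarrow> bij_betw \<sigma> U V \<Longrightarrow> s \<in> structs G U \<Longrightarrow>
           \<psi> V (transport G U \<sigma> s) = transport H U \<sigma> (\<psi> U s)"
    by (rule species_isoE[OF assms(2)], rule that)
  show ?thesis
  proof (rule species_isoI[of "\<lambda>U. \<psi> U \<circ> \<phi> U"])
    fix U :: "'a set" assume "finite U"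
    then show "bij_betw (\<psi> U \<circ> \<phi> U) (structs F U) (structs H U)"
      using bij_betw_trans[OF b b'] by simp
  next
    fix U V :: "'a set" and \<sigma> s assume *: "finite U" "bij_betw \<sigma> U V" "s \<in> structs F U"
    then have "\<phi> U s \<in> structs G U"
      using b by (auto simp: bij_betw_def)
    then show "(\<psi> V \<circ> \<phi> V) (transport F U \<sigma> s) = transport H U \<sigma> ((\<psi> U \<circ> \<phi> U) s)"
      using * by (simp add: n n')
  qed
qed


subsection \<open>Operations on species\<close>

definition zero_species :: "('a, unit) species" where
  "zero_species = mk_species (\<lambda>U. {}) (\<lambda>U \<sigma> s. s)"

definition one_species :: "('a, unit) species" where
  "one_species = mk_species (\<lambda>U. if U = {} then {()} else {}) (\<lambda>U \<sigma> s. s)"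

definition set_species :: "('a, unit) species" where
  "set_species = mk_species (\<lambda>U. {()}) (\<lambda>U \<sigma> s. s)"

definition nonempty_set_species :: "('a, unit) species" where
  "nonempty_set_species = mk_species (\<lambda>U. if U = {} then {} else {()}) (\<lambda>U \<sigma> s. s)"

definition species_sum :: "('a, 's) species \<Rightarrow> ('a, 't) species \<Rightarrow> ('a, 's + 't) species" where
  "species_sum F G = mk_species
     (\<lambda>U. structs F U <+> structs G U)
     (\<lambda>U \<sigma>. map_sum (transport F U \<sigma>) (transport G U \<sigma>))"

definition species_prod ::
  "('a, 's) species \<Rightarrow> ('a, 't) species \<Rightarrow> ('a, ('a set \<times> 'a set) \<times> ('s \<times> 't)) species" where
  "species_prod F G = mk_species
     (\<lambda>U. {((U1, U2), (s, t)) | U1 U2 s t.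
             U = U1 \<union> U2 \<and> U1 \<inter> U2 = {} \<and> s \<in> structs F U1 \<and> t \<in> structs G U2})
     (\<lambda>U \<sigma> ((U1, U2), (s, t)).
        ((\<sigma> ` U1, \<sigma> ` U2), (transport F U1 \<sigma> s, transport G U2 \<sigma> t)))"

text \<open>The part of a species living on sets with exactly \<open>n\<close> elements.\<close>

definition species_part :: "nat \<Rightarrow> ('a, 's) species \<Rightarrow> ('a, 's) species" where
  "species_part n F = mk_species (\<lambda>U. if card U = n then structs F U else {}) (transport F)"

text \<open>An isomorphic copy with natural numbers as structures; \<open>to_nat_on A\<close> is a bijection from the
  finite set \<open>A\<close> to an initial segment of the natural numbers.\<close>

definition nat_copy :: "('a, 's) species \<Rightarrow> ('a, nat) species" where
  "nat_copy F = mk_species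
     (\<lambda>U. to_nat_on (structs F U) ` structs F U)
     (\<lambda>U \<sigma>. to_nat_on (structs F (\<sigma> ` U)) \<circ> transport F U \<sigma> \<circ> inv_into (structs F U) (to_nat_on (structs F U)))"

lemma zero_species [simp]: "structs zero_species = (\<lambda>U. {})" "transport zero_species = (\<lambda>U \<sigma> s. s)"
  unfolding zero_species_def by (rule mk_species; simp add: species_functor_def)+

lemma one_species [simp]:
  "structs one_species = (\<lambda>U. if U = {} then {()} else {})" "transport one_species = (\<lambda>U \<sigma> s. s)"
  unfolding one_species_def by (rule mk_species; auto simp: species_functor_def bij_betw_def)+

lemma set_species [simp]: "structs set_species = (\<lambda>U. {()})" "transport set_species = (\<lambda>U \<sigma> s. s)"
  unfolding set_species_def by (rule mk_species; simp add: species_functor_def)+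

lemma nonempty_set_species [simp]:
  "structs nonempty_set_species = (\<lambda>U. if U = {} then {} else {()})"
  "transport nonempty_set_species = (\<lambda>U \<sigma> s. s)"
  unfolding nonempty_set_species_def by (rule mk_species; auto simp: species_functor_def bij_betw_def)+

lemma species_sum [simp]:
  "structs (species_sum F G) = (\<lambda>U. structs F U <+> structs G U)"
  "transport (species_sum F G) = (\<lambda>U \<sigma>. map_sum (transport F U \<sigma>) (transport G U \<sigma>))"
proof -
  have *: "species_functor (\<lambda>U. structs F U <+> structs G U)
     (\<lambda>U \<sigma>. map_sum (transport F U \<sigma>) (transport G U \<sigma>))"
    apply (rule species_functorI)
        apply (auto simp: finite_structs transport_in transport_id transport_comp)
     apply (erule (1) transport_cong; simp)+
    done
  show "structs (species_sum F G) = (\<lambda>U. structs F U <+> structs G U)"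
    "transport (species_sum F G) = (\<lambda>U \<sigma>. map_sum (transport F U \<sigma>) (transport G U \<sigma>))"
    unfolding species_sum_def by (rule mk_species[OF *])+
qed

lemma bij_betw_split:
  assumes "bij_betw \<sigma> (A \<union> B) V" "A \<inter> B = {}"
  shows "bij_betw \<sigma> A (\<sigma> ` A)" "bij_betw \<sigma> B (\<sigma> ` B)" "V = \<sigma> ` A \<union> \<sigma> ` B" "\<sigma> ` A \<inter> \<sigma> ` B = {}"
  using assms by (auto simp: bij_betw_def inj_on_def)

lemma species_prod_functor:
  "species_functor
     (\<lambda>U. {((U1, U2), (s, t)) | U1 U2 s t.
             U = U1 \<union> U2 \<and> U1 \<inter> U2 = {} \<and> s \<in> structs F U1 \<and> t \<in> structs G U2})
     (\<lambda>U \<sigma> ((U1, U2), (s, t)).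
        ((\<sigma> ` U1, \<sigma> ` U2), (transport F U1 \<sigma> s, transport G U2 \<sigma> t)))"
  (is "species_functor ?S ?T")
proof (rule species_functorI)
  fix U :: "'a set" assume U: "finite U"
  have "?S U \<subseteq> (Pow U \<times> Pow U) \<times> ((\<Union>A\<in>Pow U. structs F A) \<times> (\<Union>A\<in>Pow U. structs G A))"
    by auto
  moreover have "finite \<dots>"
    using U by (intro finite_cartesian_product finite_UN_I finite_structs)
      (auto intro: finite_subset)
  ultimately show "finite (?S U)"
    by (rule finite_subset)
next
  fix U V :: "'a set" and \<sigma> :: "'a \<Rightarrow> 'a" and x
  assume U: "finite U" and \<sigma>: "bij_betw \<sigma> U V" and x: "x \<in> ?S U"
  then obtain U1 U2 s t where 1: "x = ((U1, U2), (s, t))" "U = U1 \<union> U2" "U1 \<inter> U2 = {}"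
    "s \<in> structs F U1" "t \<in> structs G U2" by blast
  have f: "finite U1" "finite U2" using U 1 by auto
  note b = bij_betw_split[OF \<sigma>[unfolded 1(2)] 1(3)]
  show "?T U \<sigma> x \<in> ?S V"
    using 1 b transport_in[OF f(1) b(1) 1(4)] transport_in[OF f(2) b(2) 1(5)] by simp
  {
    fix \<sigma>' assume "\<And>x. x \<in> U \<Longrightarrow> \<sigma> x = \<sigma>' x"
    then have "transport F U1 \<sigma> s = transport F U1 \<sigma>' s" "transport G U2 \<sigma> t = transport G U2 \<sigma>' t"
      "\<sigma> ` U1 = \<sigma>' ` U1" "\<sigma> ` U2 = \<sigma>' ` U2"
      using transport_cong[OF f(1) b(1) _ 1(4)] transport_cong[OF f(2) b(2) _ 1(5)] 1(2) by auto
    then show "?T U \<sigma> x = ?T U \<sigma>' x"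
      by (simp add: 1(1))
  next
    fix W and \<tau> :: "'a \<Rightarrow> 'a" assume \<tau>: "bij_betw \<tau> V W"
    note b' = bij_betw_split[OF \<tau>[unfolded b(3)] b(4)]
    show "?T U (\<tau> \<circ> \<sigma>) x = ?T V \<tau> (?T U \<sigma> x)"
      using transport_comp[OF f(1) b(1) b'(1) 1(4)] transport_comp[OF f(2) b(2) b'(2) 1(5)]
      by (simp add: 1(1) image_comp)
  }
next
  fix U :: "'a set" and x assume "finite U" "x \<in> ?S U"
  then show "?T U id x = x"
    by (auto simp: transport_id)
qed

lemma species_prod [simp]:
  "structs (species_prod F G) = (\<lambda>U. {((U1, U2), (s, t)) | U1 U2 s t.
             U = U1 \<union> U2 \<and> U1 \<inter> U2 = {} \<and> s \<in> structs F U1 \<and> t \<in> structs G U2})"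
  "transport (species_prod F G) = (\<lambda>U \<sigma> ((U1, U2), (s, t)).
        ((\<sigma> ` U1, \<sigma> ` U2), (transport F U1 \<sigma> s, transport G U2 \<sigma> t)))"
  unfolding species_prod_def by (rule mk_species[OF species_prod_functor])+

lemma species_part [simp]:
  "structs (species_part n F) = (\<lambda>U. if card U = n then structs F U else {})"
  "transport (species_part n F) = transport F"
proof -
  have *: "species_functor (\<lambda>U. if card U = n then structs F U else {}) (transport F)"
    apply (rule species_functorI)
        apply (auto simp: finite_structs transport_in transport_id transport_comp bij_betw_same_card
        split: if_splits)
    apply (erule (1) transport_cong; simp)
    done
  show "structs (species_part n F) = (\<lambda>U. if card U = n then structs F U else {})"
    "transport (species_part n F) = transport F"
    unfolding species_part_def by (rule mk_species[OF *])+
qed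

lemma inj_on_to_nat_structs: "finite U \<Longrightarrow> inj_on (to_nat_on (structs F U)) (structs F U)"
  by (simp add: countable_finite finite_structs inj_on_to_nat_on)

lemma nat_copy:
  "structs (nat_copy F) = (\<lambda>U. to_nat_on (structs F U) ` structs F U)"
  "transport (nat_copy F) = (\<lambda>U \<sigma>. to_nat_on (structs F (\<sigma> ` U)) \<circ> transport F U \<sigma> \<circ>
     inv_into (structs F U) (to_nat_on (structs F U)))"
proof -
  have *: "species_functor (\<lambda>U. to_nat_on (structs F U) ` structs F U)
     (\<lambda>U \<sigma>. to_nat_on (structs F (\<sigma> ` U)) \<circ> transport F U \<sigma> \<circ>
       inv_into (structs F U) (to_nat_on (structs F U)))"
  proof (rule species_functorI, goal_cases)
    case (1 U) then show ?case by (simp add: finite_structs)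
  next
    case (2 U V \<sigma> s)
    then have "\<sigma> ` U = V" by (simp add: bij_betw_def)
    with 2 show ?case
      by (auto simp: inv_into_f_f[OF inj_on_to_nat_structs] intro!: imageI transport_in)
  next
    case (3 U V \<sigma> \<sigma>' s)
    then have "\<sigma> ` U = V" "\<sigma>' ` U = V" by (auto simp: bij_betw_def)
    with 3 show ?case
      by (auto simp: inv_into_f_f[OF inj_on_to_nat_structs] intro!: arg_cong[of _ _ "to_nat_on _"] transport_cong)
  next
    case (4 U s)
    then show ?case by (auto simp: inv_into_f_f[OF inj_on_to_nat_structs] transport_id)
  next
    case (5 U V W \<sigma> \<tau> s)
    then have V: "\<sigma> ` U = V" "\<tau> ` V = W" "finite V" by (auto simp: bij_betw_def)
    obtain t where t: "t \<in> structs F U" "s = to_nat_on (structs F U) t" using 5 by blast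
    have "transport F U \<sigma> t \<in> structs F V"
      using 5 t by (simp add: transport_in)
    moreover have "(\<tau> \<circ> \<sigma>) ` U = W"
      using V by auto
    ultimately show ?case
      using V t transport_comp[OF 5(1-3) t(1)] \<open>finite U\<close>
      by (simp add: inv_into_f_f[OF inj_on_to_nat_structs])
  qed
  show "structs (nat_copy F) = (\<lambda>U. to_nat_on (structs F U) ` structs F U)"
    "transport (nat_copy F) = (\<lambda>U \<sigma>. to_nat_on (structs F (\<sigma> ` U)) \<circ> transport F U \<sigma> \<circ>
     inv_into (structs F U) (to_nat_on (structs F U)))"
    unfolding nat_copy_def by (rule mk_species[OF *])+
qed

lemma species_iso_nat_copy: "species_iso F (nat_copy F)"
proof (rule species_isoI[of "\<lambda>U. to_nat_on (structs F U)"])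
  fix U :: "'a set" assume "finite U"
  then show "bij_betw (to_nat_on (structs F U)) (structs F U) (structs (nat_copy F) U)"
    by (simp add: nat_copy bij_betw_def inj_on_to_nat_structs)
next
  fix U V :: "'a set" and \<sigma> s
  assume "finite U" "bij_betw \<sigma> U V" "s \<in> structs F U"
  then show "to_nat_on (structs F V) (transport F U \<sigma> s) =
    transport (nat_copy F) U \<sigma> (to_nat_on (structs F U) s)"
    by (auto simp: nat_copy inv_into_f_f[OF inj_on_to_nat_structs] bij_betw_def)
qed

lemma bij_betw_map_sum:
  assumes "bij_betw f A A'" "bij_betw g B B'"
  shows "bij_betw (map_sum f g) (A <+> B) (A' <+> B')"
  unfolding bij_betw_def
proof
  show "inj_on (map_sum f g) (A <+> B)"
    using assms[THEN bij_betw_imp_inj_on] by (auto intro!: inj_onI dest: inj_onD)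
  show "map_sum f g ` (A <+> B) = A' <+> B'"
    using assms[THEN bij_betw_imp_surj_on, symmetric] by (simp add: Plus_def image_Un image_image)
qed

lemma species_sum_cong:
  assumes "species_iso F F'" "species_iso G G'"
  shows "species_iso (species_sum F G) (species_sum F' G')"
proof -
  obtain \<phi> where b: "\<And>U. finite U \<Longrightarrow> bij_betw (\<phi> U) (structs F U) (structs F' U)"
    and n: "\<And>U V \<sigma> s. finite U \<Longrightarrow> bij_betw \<sigma> U V \<Longrightarrow> s \<in> structs F U \<Longrightarrow>
           \<phi> V (transport F U \<sigma> s) = transport F' U \<sigma> (\<phi> U s)"
    by (rule species_isoE[OF assms(1)], rule that)
  obtain \<psi> where b': "\<And>U. finite U \<Longrightarrow> bij_betw (\<psi> U) (structs G U) (structs G' U)"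
    and n': "\<And>U V \<sigma> s. finite U \<Longrightarrow> bij_betw \<sigma> U V \<Longrightarrow> s \<in> structs G U \<Longrightarrow>
           \<psi> V (transport G U \<sigma> s) = transport G' U \<sigma> (\<psi> U s)"
    by (rule species_isoE[OF assms(2)], rule that)
  show ?thesis
  proof (rule species_isoI[of "\<lambda>U. map_sum (\<phi> U) (\<psi> U)"])
    fix U :: "'a set" assume "finite U"
    then show "bij_betw (map_sum (\<phi> U) (\<psi> U)) (structs (species_sum F G) U) (structs (species_sum F' G') U)"
      using b[of U] b'[of U] by (simp add: bij_betw_map_sum)
  qed (auto simp: n n')
qed

lemma species_prod_cong:
  assumes "species_iso F F'" "species_iso G G'"
  shows "species_iso (species_prod F G) (species_prod F' G')"
proof -
  obtain \<phi> where b: "\<And>U. finite U \<Longrightarrow> bij_betw (\<phi> U) (structs F U) (structs F' U)"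
    and n: "\<And>U V \<sigma> s. finite U \<Longrightarrow> bij_betw \<sigma> U V \<Longrightarrow> s \<in> structs F U \<Longrightarrow>
           \<phi> V (transport F U \<sigma> s) = transport F' U \<sigma> (\<phi> U s)"
    by (rule species_isoE[OF assms(1)], rule that)
  obtain \<psi> where b': "\<And>U. finite U \<Longrightarrow> bij_betw (\<psi> U) (structs G U) (structs G' U)"
    and n': "\<And>U V \<sigma> s. finite U \<Longrightarrow> bij_betw \<sigma> U V \<Longrightarrow> s \<in> structs G U \<Longrightarrow>
           \<psi> V (transport G U \<sigma> s) = transport G' U \<sigma> (\<psi> U s)"
    by (rule species_isoE[OF assms(2)], rule that)
  let ?\<chi> = "\<lambda>(U :: 'a set) ((U1, U2), (s, t)). ((U1, U2), (\<phi> U1 s, \<psi> U2 t))"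
  show ?thesis
  proof (rule species_isoI[of ?\<chi>])
    fix U :: "'a set" assume U: "finite U"
    show "bij_betw (?\<chi> U) (structs (species_prod F G) U) (structs (species_prod F' G') U)"
      unfolding bij_betw_def
    proof
      show "inj_on (?\<chi> U) (structs (species_prod F G) U)"
      proof (rule inj_onI)
        fix x y assume x: "x \<in> structs (species_prod F G) U" and y: "y \<in> structs (species_prod F G) U"
          and eq: "?\<chi> U x = ?\<chi> U y"
        from x obtain U1 U2 s t where 1: "x = ((U1, U2), (s, t))" "U = U1 \<union> U2"
          "s \<in> structs F U1" "t \<in> structs G U2" by auto
        from y 1 eq obtain s' t' where 2: "y = ((U1, U2), (s', t'))"
          "s' \<in> structs F U1" "t' \<in> structs G U2" "\<phi> U1 s = \<phi> U1 s'" "\<psi> U2 t = \<psi> U2 t'" by auto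
        have "finite U1" "finite U2" using U 1 by auto
        then show "x = y"
          using 1 2 b[THEN bij_betw_imp_inj_on, of U1] b'[THEN bij_betw_imp_inj_on, of U2]
          by (simp add: inj_on_eq_iff)
      qed
      show "?\<chi> U ` structs (species_prod F G) U = structs (species_prod F' G') U"
      proof (intro equalityI subsetI)
        fix x assume "x \<in> ?\<chi> U ` structs (species_prod F G) U"
        then show "x \<in> structs (species_prod F' G') U"
          using U by (auto simp: bij_betw_apply[OF b] bij_betw_apply[OF b'])
      next
        fix x assume "x \<in> structs (species_prod F' G') U"
        then obtain U1 U2 s' t' where 1: "x = ((U1, U2), (s', t'))" "U = U1 \<union> U2" "U1 \<inter> U2 = {}"
          "s' \<in> structs F' U1" "t' \<in> structs G' U2" by auto
        moreover from this U have "s' \<in> \<phi> U1 ` structs F U1" "t' \<in> \<psi> U2 ` structs G U2"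
          using b[of U1] b'[of U2] by (simp_all add: bij_betw_def)
        ultimately obtain s t where "s \<in> structs F U1" "s' = \<phi> U1 s" "t \<in> structs G U2" "t' = \<psi> U2 t"
          by blast
        with 1 have "((U1, U2), (s, t)) \<in> structs (species_prod F G) U" "x = ?\<chi> U ((U1, U2), (s, t))"
          by auto
        then show "x \<in> ?\<chi> U ` structs (species_prod F G) U"
          by blast
      qed
    qed
  next
    fix U V :: "'a set" and \<sigma> x
    assume U: "finite U" and \<sigma>: "bij_betw \<sigma> U V" and "x \<in> structs (species_prod F G) U"
    then obtain U1 U2 s t where 1: "x = ((U1, U2), (s, t))" "U = U1 \<union> U2" "U1 \<inter> U2 = {}"
      "s \<in> structs F U1" "t \<in> structs G U2" by auto
    have f: "finite U1" "finite U2" using U 1 by auto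
    note b = bij_betw_split[OF \<sigma>[unfolded 1(2)] 1(3)]
    show "?\<chi> V (transport (species_prod F G) U \<sigma> x) = transport (species_prod F' G') U \<sigma> (?\<chi> U x)"
      using n[OF f(1) b(1) 1(4)] n'[OF f(2) b(2) 1(5)] by (simp add: 1(1))
  qed
qed

lemma species_part_cong:
  assumes "species_iso F G" shows "species_iso (species_part n F) (species_part n G)"
proof -
  obtain \<phi> where b: "\<And>U. finite U \<Longrightarrow> bij_betw (\<phi> U) (structs F U) (structs G U)"
    and n: "\<And>U V \<sigma> s. finite U \<Longrightarrow> bij_betw \<sigma> U V \<Longrightarrow> s \<in> structs F U \<Longrightarrow>
           \<phi> V (transport F U \<sigma> s) = transport G U \<sigma> (\<phi> U s)"
    by (rule species_isoE[OF assms(1)], rule that)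
  show ?thesis
    by (rule species_isoI[of \<phi>]) (auto simp: b n bij_betw_def[of _ "{}"] split: if_splits)
qed


subsection \<open>Cancellation\<close>

text \<open>
  A natural bijection between \<open>F + H\<close> and \<open>G + H\<close> yields one between \<open>F\<close> and \<open>G\<close>:
  start in \<open>F\<close> and iterate, re-entering through \<open>H\<close>, until \<open>G\<close> is reached.
\<close>

inductive iter_reach :: "('s + 'u \<Rightarrow> 't + 'u) \<Rightarrow> 's + 'u \<Rightarrow> 't + 'u \<Rightarrow> bool" for f x where
  start: "iter_reach f x (f x)"
| step: "iter_reach f x (Inr h) \<Longrightarrow> iter_reach f x (f (Inr h))"

lemma iter_reach_in:
  assumes "iter_reach f x y" "f ` (A <+> C) \<subseteq> B <+> C" "x \<in> A <+> C"
  shows "y \<in> B <+> C"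
  using assms by induction (auto simp: image_subset_iff)

lemma iter_reach_forward:
  assumes "iter_reach f x y"
  shows "y = f x \<or> (\<exists>h. f x = Inr h \<and> iter_reach f (Inr h) y)"
  using assms
proof induction
  case start then show ?case by simp
next
  case (step h)
  then show ?case
    using iter_reach.start[of f "Inr h"] iter_reach.step[of f _ h] by metis
qed

lemma iter_reach_compare:
  assumes "iter_reach f x y" "iter_reach f x (Inl b)"
  shows "y = Inl b \<or> (\<exists>h. y = Inr h \<and> iter_reach f (Inr h) (Inl b))"
  using assms
proof induction
  case start then show ?case using iter_reach_forward by metis
next
  case (step h)
  then have "iter_reach f (Inr h) (Inl b)" by auto
  then show ?case using iter_reach_forward by metis
qed

lemma iter_reach_unique: "iter_reach f x (Inl b) \<Longrightarrow> iter_reach f x (Inl b') \<Longrightarrow> b = b'"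
  using iter_reach_compare by fastforce

lemma iter_reach_inj:
  assumes "iter_reach f (Inl a) y" "iter_reach f (Inl a') y"
    and inj: "inj_on f (A <+> C)" and f: "f ` (A <+> C) \<subseteq> B <+> C" and a: "a \<in> A" "a' \<in> A"
  shows "a = a'"
  using assms(1,2)
proof induction
  case start
  from start show ?case
  proof (cases rule: iter_reach.cases)
    case start
    then show ?thesis using inj_onD[OF inj, of "Inl a" "Inl a'"] a by (simp add: InlI)
  next
    case (step h)
    have "Inr h \<in> A <+> C"
      using iter_reach_in[OF step(2) f] a by auto
    then show ?thesis using step(1) inj_onD[OF inj, of "Inl a" "Inr h"] a by (simp add: InlI)
  qed
next
  case (step h)
  have h: "Inr h \<in> A <+> C"
    using iter_reach_in[OF step(1) f] a by auto
  from step(3) show ?case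
  proof (cases rule: iter_reach.cases)
    case start
    then show ?thesis using inj_onD[OF inj, of "Inr h" "Inl a'"] a h by (simp add: InlI)
  next
    case (step h')
    have "Inr h' \<in> A <+> C"
      using iter_reach_in[OF step(2) f] a by auto
    then have "h = h'" using h step(1) inj_onD[OF inj, of "Inr h" "Inr h'"] by simp
    then show ?thesis using step(2) \<open>iter_reach f (Inl a') (Inr h) \<Longrightarrow> a = a'\<close> by simp
  qed
qed

lemma iter_reach_exists:
  assumes inj: "inj_on f (A <+> C)" and f: "f ` (A <+> C) \<subseteq> B <+> C" and a: "a \<in> A"
    and C: "finite C"
  shows "\<exists>b\<in>B. iter_reach f (Inl a) (Inl b)"
proof (rule ccontr)
  assume neg: "\<not> ?thesis"
  define R where "R = {h. iter_reach f (Inl a) (Inr h)}"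
  have RC: "R \<subseteq> C"
    using iter_reach_in[OF _ f, of "Inl a"] a by (auto simp: R_def)
  have "finite R" using RC C by (rule finite_subset)
  have ex: "y \<in> Inr ` R" if "iter_reach f (Inl a) y" for y
    using that neg iter_reach_in[OF that f] a by (cases y) (auto simp: R_def)
  have "f ` ({a} <+> R) \<subseteq> Inr ` R"
    using ex iter_reach.intros[of f "Inl a"] by (auto simp: R_def)
  moreover have "inj_on f ({a} <+> R)"
    using inj by (rule inj_on_subset) (use a RC in auto)
  ultimately have "card ({a} <+> R) \<le> card (Inr ` R :: ('c + 'b) set)"
    using \<open>finite R\<close> by (intro card_inj_on_le[of f]) auto
  then show False
    using \<open>finite R\<close> by (simp add: card_Plus card_image)
qed

lemma iter_reach_natural:
  assumes "iter_reach f x y" "f ` (A <+> C) \<subseteq> B <+> C" "x \<in> A <+> C"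
    and "\<And>z. z \<in> A <+> C \<Longrightarrow> f' (map_sum \<alpha> \<gamma> z) = map_sum \<beta> \<gamma> (f z)"
  shows "iter_reach f' (map_sum \<alpha> \<gamma> x) (map_sum \<beta> \<gamma> y)"
  using assms(1)
proof induction
  case start
  show ?case using iter_reach.start[of f' "map_sum \<alpha> \<gamma> x"] assms(3,4) by simp
next
  case (step h)
  have "Inr h \<in> A <+> C"
    using iter_reach_in[OF step(1) assms(2,3)] by auto
  then show ?case
    using iter_reach.step[of f' "map_sum \<alpha> \<gamma> x" "\<gamma> h"] step(2) assms(4)[of "Inr h"] by simp
qed

lemma species_iso_cancel:
  fixes F :: "('a, 's) species" and G :: "('a, 't) species" and H :: "('a, 'u) species"
  assumes "species_iso (species_sum F H) (species_sum G H)"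
  shows "species_iso F G"
proof -
  obtain \<phi> where b: "\<And>U. finite U \<Longrightarrow> bij_betw (\<phi> U) (structs F U <+> structs H U) (structs G U <+> structs H U)"
    and n: "\<And>U V \<sigma> s. finite U \<Longrightarrow> bij_betw \<sigma> U V \<Longrightarrow> s \<in> structs F U <+> structs H U \<Longrightarrow>
           \<phi> V (map_sum (transport F U \<sigma>) (transport H U \<sigma>) s) =
           map_sum (transport G U \<sigma>) (transport H U \<sigma>) (\<phi> U s)"
    by (rule species_isoE[OF assms, unfolded species_sum], rule that)
  define \<psi> where "\<psi> U s = (THE t. iter_reach (\<phi> U) (Inl s) (Inl t))" for U s
  have inj: "inj_on (\<phi> U) (structs F U <+> structs H U)" if "finite U" for U
    using b[OF that] by (rule bij_betw_imp_inj_on)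
  have im: "\<phi> U ` (structs F U <+> structs H U) \<subseteq> structs G U <+> structs H U" if "finite U" for U
    using b[OF that] by (simp add: bij_betw_def)
  have \<psi>_eq: "\<psi> U s = t" if "iter_reach (\<phi> U) (Inl s) (Inl t)" for U s t
    unfolding \<psi>_def using that by (rule the_equality) (rule iter_reach_unique[OF _ that])
  have \<psi>: "\<psi> U s \<in> structs G U" "iter_reach (\<phi> U) (Inl s) (Inl (\<psi> U s))"
    if U: "finite U" and s: "s \<in> structs F U" for U s
    using iter_reach_exists[OF inj[OF U] im[OF U] s finite_structs[OF U]] \<psi>_eq by auto
  show ?thesis
  proof (rule species_isoI[of \<psi>])
    fix U :: "'a set" assume U: "finite U"
    have inj\<psi>: "inj_on (\<psi> U) (structs F U)"
    proof (rule inj_onI)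
      fix s s' assume s: "s \<in> structs F U" "s' \<in> structs F U" and eq: "\<psi> U s = \<psi> U s'"
      show "s = s'"
        using iter_reach_inj[OF \<psi>(2)[OF U s(1)] _ inj[OF U] im[OF U] s] \<psi>(2)[OF U s(2)] eq by simp
    qed
    have "card (structs F U <+> structs H U) = card (structs G U <+> structs H U)"
      using b[OF U] by (rule bij_betw_same_card)
    then have card: "card (structs F U) = card (structs G U)"
      using U by (simp add: card_Plus finite_structs)
    have "\<psi> U ` structs F U = structs G U"
      using U \<psi>(1)[OF U] by (intro card_subset_eq) (auto simp: finite_structs card_image[OF inj\<psi>] card)
    with inj\<psi> show "bij_betw (\<psi> U) (structs F U) (structs G U)"
      by (simp add: bij_betw_def)
  next
    fix U V :: "'a set" and \<sigma> s assume U: "finite U" and \<sigma>: "bij_betw \<sigma> U V" and s: "s \<in> structs F U"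
    have "iter_reach (\<phi> V) (map_sum (transport F U \<sigma>) (transport H U \<sigma>) (Inl s))
      (map_sum (transport G U \<sigma>) (transport H U \<sigma>) (Inl (\<psi> U s)))"
      by (rule iter_reach_natural[OF \<psi>(2)[OF U s] im[OF U] _ n[OF U \<sigma>]]) (use s in auto)
    then show "\<psi> V (transport F U \<sigma> s) = transport G U \<sigma> (\<psi> U s)"
      by (intro \<psi>_eq) simp
  qed
qed


subsection \<open>Semiring laws up to isomorphism\<close>

lemma species_iso_witness:
  assumes "\<And>U s. finite U \<Longrightarrow> s \<in> structs F U \<Longrightarrow> \<phi> U s \<in> structs G U \<and> \<psi> U (\<phi> U s) = s"
    and "\<And>U t. finite U \<Longrightarrow> t \<in> structs G U \<Longrightarrow> \<psi> U t \<in> structs F U \<and> \<phi> U (\<psi> U t) = t"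
    and "\<And>U V \<sigma> s. finite U \<Longrightarrow> finite V \<Longrightarrow> bij_betw \<sigma> U V \<Longrightarrow> s \<in> structs F U \<Longrightarrow>
           \<phi> V (transport F U \<sigma> s) = transport G U \<sigma> (\<phi> U s)"
  shows "species_iso F G"
proof (rule species_isoI[of \<phi>])
  fix U :: "'a set" assume "finite U"
  then show "bij_betw (\<phi> U) (structs F U) (structs G U)"
    using assms(1,2)[of U] by (intro bij_betw_byWitness[of _ "\<psi> U"]) auto
qed (use assms(3) in simp)

lemma species_sum_comm: "species_iso (species_sum F G) (species_sum G F)"
  by (rule species_iso_witness[of _ "\<lambda>_. case_sum Inr Inl" _ "\<lambda>_. case_sum Inr Inl"]) auto

lemma species_sum_assoc:
  "species_iso (species_sum (species_sum F G) H) (species_sum F (species_sum G H))"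
  by (rule species_iso_witness[of _ "\<lambda>_. case_sum (case_sum Inl (Inr \<circ> Inl)) (Inr \<circ> Inr)"
        _ "\<lambda>_. case_sum (Inl \<circ> Inl) (case_sum (Inl \<circ> Inr) Inr)"]) auto

lemma species_sum_zero: "species_iso (species_sum zero_species F) F"
  by (rule species_iso_witness[of _ "\<lambda>_. case_sum undefined id" _ "\<lambda>_. Inr"]) auto

lemma species_prod_comm: "species_iso (species_prod F G) (species_prod G F)"
  by (rule species_iso_witness[of _ "\<lambda>_ ((A, B), (s, t)). ((B, A), (t, s))"
        _ "\<lambda>_ ((A, B), (s, t)). ((B, A), (t, s))"]) auto

lemma species_prod_assoc:
  "species_iso (species_prod (species_prod F G) H) (species_prod F (species_prod G H))"
proof (rule species_iso_witness[of _ "\<lambda>_ ((_, C), (((A, B), (s, t)), u)). ((A, B \<union> C), (s, ((B, C), (t, u))))"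
        _ "\<lambda>_ ((A, _), (s, ((B, C), (t, u)))). ((A \<union> B, C), (((A, B), (s, t)), u))"], goal_cases)
  case (1 U s) then show ?case by auto
next
  case (2 U t) then show ?case by auto
next
  case (3 U V \<sigma> s) then show ?case by (auto simp: image_Un)
qed

lemma species_prod_one: "species_iso (species_prod one_species F) F"
  by (rule species_iso_witness[of _ "\<lambda>_ (_, (_, t)). t" _ "\<lambda>U t. (({}, U), ((), t))"])
    (auto split: if_splits)

lemma species_prod_zero: "species_iso (species_prod zero_species F) zero_species"
  by (rule species_iso_witness[of _ "\<lambda>_ _. ()" _ "\<lambda>_ _. undefined"]) auto

lemma species_prod_distrib:
  "species_iso (species_prod (species_sum F G) H) (species_sum (species_prod F H) (species_prod G H))"
  by (rule species_iso_witness[of _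
        "\<lambda>_ (P, (s, u)). case s of Inl a \<Rightarrow> Inl (P, (a, u)) | Inr b \<Rightarrow> Inr (P, (b, u))" _
        "\<lambda>_ x. case x of Inl (P, (a, u)) \<Rightarrow> (P, (Inl a, u)) | Inr (P, (b, u)) \<Rightarrow> (P, (Inr b, u))"])
    (auto split: sum.splits)

lemma species_part_sum:
  "species_iso (species_part n (species_sum F G)) (species_sum (species_part n F) (species_part n G))"
  by (rule species_iso_witness[of _ "\<lambda>_ s. s" _ "\<lambda>_ s. s"]) (auto split: if_splits)

lemma species_iso_parts:
  assumes "\<And>n. species_iso (species_part n F) (species_part n G)"
  shows "species_iso F G"
proof -
  have "\<forall>n. \<exists>\<phi>. (\<forall>U. finite U \<longrightarrow> bij_betw (\<phi> U) (structs (species_part n F) U) (structs (species_part n G) U)) \<and>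
     (\<forall>U V \<sigma>. finite U \<longrightarrow> bij_betw \<sigma> U V \<longrightarrow>
        (\<forall>s\<in>structs (species_part n F) U. \<phi> V (transport (species_part n F) U \<sigma> s) =
            transport (species_part n G) U \<sigma> (\<phi> U s)))"
    using assms unfolding species_iso_def by (rule allI)
  from choice[OF this] obtain \<phi> where
    "\<forall>n. (\<forall>U. finite U \<longrightarrow> bij_betw (\<phi> n U) (structs (species_part n F) U) (structs (species_part n G) U)) \<and>
     (\<forall>U V \<sigma>. finite U \<longrightarrow> bij_betw \<sigma> U V \<longrightarrow>
        (\<forall>s\<in>structs (species_part n F) U. \<phi> n V (transport (species_part n F) U \<sigma> s) =
            transport (species_part n G) U \<sigma> (\<phi> n U s)))"
    by (elim exE)
  then have b: "\<And>n U. finite U \<Longrightarrow> bij_betw (\<phi> n U) (structs (species_part n F) U) (structs (species_part n G) U)"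
    and n: "\<And>n U V \<sigma> s. finite U \<Longrightarrow> bij_betw \<sigma> U V \<Longrightarrow> s \<in> structs (species_part n F) U \<Longrightarrow>
      \<phi> n V (transport (species_part n F) U \<sigma> s) = transport (species_part n G) U \<sigma> (\<phi> n U s)"
    by simp_all
  show ?thesis
  proof (rule species_isoI[of "\<lambda>U. \<phi> (card U) U"])
    fix U :: "'a set" assume "finite U"
    from b[OF this, of "card U"] show "bij_betw (\<phi> (card U) U) (structs F U) (structs G U)"
      by simp
  next
    fix U V :: "'a set" and \<sigma> s assume "finite U" "bij_betw \<sigma> U V" "s \<in> structs F U"
    then show "\<phi> (card V) V (transport F U \<sigma> s) = transport G U \<sigma> (\<phi> (card U) U s)"
      using n[of U \<sigma> V s "card U"] by (simp add: bij_betw_same_card)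
  qed
qed


section \<open>The semiring of species up to isomorphism\<close>

text \<open>
  Every species is isomorphic to one whose structures are natural numbers, so that the
  isomorphism classes of the latter are all isomorphism classes.
\<close>

quotient_type 'a spe = "('a, nat) species" / species_iso
  by (rule equivpI) (auto simp: reflp_def symp_def transp_def
      intro: species_iso_refl species_iso_sym species_iso_trans)

definition spe_of :: "('a, 's) species \<Rightarrow> 'a spe" where
  "spe_of F = abs_spe (nat_copy F)"

lemma spe_of_eq_iff: "spe_of F = spe_of G \<longleftrightarrow> species_iso F G"
  unfolding spe_of_def spe.abs_eq_iff
  by (meson species_iso_nat_copy species_iso_sym species_iso_trans)

lemma spe_of_eq_abs: "spe_of F = abs_spe F"
  unfolding spe_of_def spe.abs_eq_iff by (rule species_iso_sym, rule species_iso_nat_copy)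

lemma spe_cases: obtains F :: "('a, nat) species" where "x = spe_of F"
proof -
  have "\<exists>F :: ('a, nat) species. x = spe_of F"
    unfolding spe_of_eq_abs by (rule spe.abs_induct[of _ x]) blast
  then show thesis using that by blast
qed

instantiation spe :: (type) comm_semiring_1
begin

definition zero_spe :: "'a spe" where "0 = spe_of zero_species"

definition one_spe :: "'a spe" where "1 = spe_of one_species"

lift_definition plus_spe :: "'a spe \<Rightarrow> 'a spe \<Rightarrow> 'a spe"
  is "\<lambda>F G. nat_copy (species_sum F G)"
  by (meson species_sum_cong species_iso_nat_copy species_iso_sym species_iso_trans)

lift_definition times_spe :: "'a spe \<Rightarrow> 'a spe \<Rightarrow> 'a spe"
  is "\<lambda>F G. nat_copy (species_prod F G)"
  by (meson species_prod_cong species_iso_nat_copy species_iso_sym species_iso_trans)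

lemma spe_of_sum_aux: "spe_of F + spe_of G = spe_of (species_sum F G)"
  unfolding spe_of_def plus_spe.abs_eq spe.abs_eq_iff
  by (meson species_sum_cong species_iso_nat_copy species_iso_sym species_iso_trans)

lemma spe_of_prod_aux: "spe_of F * spe_of G = spe_of (species_prod F G)"
  unfolding spe_of_def times_spe.abs_eq spe.abs_eq_iff
  by (meson species_prod_cong species_iso_nat_copy species_iso_sym species_iso_trans)

instance
proof
  fix a b c :: "'a spe"
  obtain F :: "('a, nat) species" where a: "a = spe_of F" by (rule spe_cases)
  obtain G :: "('a, nat) species" where b: "b = spe_of G" by (rule spe_cases)
  obtain H :: "('a, nat) species" where c: "c = spe_of H" by (rule spe_cases)
  note defs = a b c zero_spe_def one_spe_def spe_of_sum_aux spe_of_prod_aux spe_of_eq_iff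
  show "a * b * c = a * (b * c)" unfolding defs by (rule species_prod_assoc)
  show "a * b = b * a" unfolding defs by (rule species_prod_comm)
  show "1 * a = a" unfolding defs by (rule species_prod_one)
  show "a + b + c = a + (b + c)" unfolding defs by (rule species_sum_assoc)
  show "a + b = b + a" unfolding defs by (rule species_sum_comm)
  show "0 + a = a" unfolding defs by (rule species_sum_zero)
  show "(a + b) * c = a * c + b * c" unfolding defs by (rule species_prod_distrib)
  show 0: "0 * a = 0" unfolding defs by (rule species_prod_zero)
  have "a * 0 = 0 * a" unfolding defs by (rule species_prod_comm)
  with 0 show "a * 0 = 0" by simp
  show "(0 :: 'a spe) \<noteq> 1"
    unfolding defs
  proof
    assume "species_iso (zero_species :: ('a, unit) species) one_species"
    then show False
    proof (rule species_isoE)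
      fix \<phi> :: "'a set \<Rightarrow> unit \<Rightarrow> unit"
      assume "\<And>U. finite U \<Longrightarrow> bij_betw (\<phi> U) (structs zero_species U) (structs one_species U)"
      from this[of "{}"] show False by (simp add: bij_betw_def)
    qed
  qed
qed

end

lemma spe_of_sum: "spe_of (species_sum F G) = spe_of F + spe_of G"
  by (simp add: spe_of_sum_aux)

lemma spe_of_prod: "spe_of (species_prod F G) = spe_of F * spe_of G"
  by (simp add: spe_of_prod_aux)

lemma spe_add_right_cancel: "a + c = b + c \<longleftrightarrow> a = b" for a b c :: "'a spe"
proof
  obtain F :: "('a, nat) species" where a: "a = spe_of F" by (rule spe_cases)
  obtain G :: "('a, nat) species" where b: "b = spe_of G" by (rule spe_cases)
  obtain H :: "('a, nat) species" where c: "c = spe_of H" by (rule spe_cases)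
  assume "a + c = b + c"
  then show "a = b"
    unfolding a b c spe_of_sum[symmetric] spe_of_eq_iff by (rule species_iso_cancel)
qed simp

instance spe :: (type) cancel_semigroup_add
proof
  fix a b c :: "'a spe"
  show "a + b = a + c \<Longrightarrow> b = c"
    using spe_add_right_cancel[of b a c] by (simp add: add.commute)
qed (simp add: spe_add_right_cancel)

lift_definition spe_part :: "nat \<Rightarrow> 'a spe \<Rightarrow> 'a spe" is species_part
  by (rule species_part_cong)

lemma spe_part_spe_of: "spe_part n (spe_of F) = spe_of (species_part n F)"
  unfolding spe_of_def spe_part.abs_eq spe.abs_eq_iff
  by (meson species_part_cong species_iso_nat_copy species_iso_sym species_iso_trans)

lemma spe_part_add: "spe_part n (a + b) = spe_part n a + spe_part n b"
proof -
  obtain F :: "('a, nat) species" where a: "a = spe_of F" by (rule spe_cases)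
  obtain G :: "('a, nat) species" where b: "b = spe_of G" by (rule spe_cases)
  show ?thesis
    unfolding a b spe_of_sum[symmetric] spe_part_spe_of spe_of_eq_iff by (rule species_part_sum)
qed

lemma spe_eq_parts:
  assumes "\<And>n. spe_part n a = spe_part n b" shows "a = b"
proof -
  obtain F :: "('a, nat) species" where a: "a = spe_of F" by (rule spe_cases)
  obtain G :: "('a, nat) species" where b: "b = spe_of G" by (rule spe_cases)
  show ?thesis
    using assms unfolding a b spe_part_spe_of spe_of_eq_iff by (rule species_iso_parts)
qed


section \<open>Virtual species\<close>

lifting_forget spe.lifting

definition virt_eq :: "'a spe \<times> 'a spe \<Rightarrow> 'a spe \<times> 'a spe \<Rightarrow> bool" where
  "virt_eq = (\<lambda>(F, G) (H, K). F + K = G + H)"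

lemma virt_eq_iff [simp]: "virt_eq (F, G) (H, K) \<longleftrightarrow> F + K = G + H"
  by (simp add: virt_eq_def)

quotient_type 'a virt = "'a spe \<times> 'a spe" / virt_eq
proof (rule equivpI)
  show "reflp (virt_eq :: 'a spe \<times> 'a spe \<Rightarrow> _)" by (auto simp: reflp_def add.commute)
  show "symp (virt_eq :: 'a spe \<times> 'a spe \<Rightarrow> _)" by (auto simp: symp_def add.commute)
  show "transp (virt_eq :: 'a spe \<times> 'a spe \<Rightarrow> _)"
  proof (rule transpI, clarsimp)
    fix a b c d e f :: "'a spe"
    assume 1: "a + d = b + c" and 2: "c + f = d + e"
    have "(a + f) + d = (a + d) + f" by (simp add: ac_simps)
    also have "\<dots> = b + (c + f)" by (simp add: 1 ac_simps)
    also have "\<dots> = (b + e) + d" by (simp add: 2 ac_simps)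
    finally show "a + f = b + e" by (simp only: spe_add_right_cancel)
  qed
qed

instantiation virt :: (type) comm_ring_1
begin

lift_definition zero_virt :: "'a virt" is "(0, 0)" .

lift_definition one_virt :: "'a virt" is "(1, 0)" .

lift_definition plus_virt :: "'a virt \<Rightarrow> 'a virt \<Rightarrow> 'a virt"
  is "\<lambda>(F, G) (H, K). (F + H, G + K)"
proof clarsimp
  fix a b c d a' b' c' d' :: "'a spe"
  assume 1: "a + d = b + c" and 2: "a' + d' = b' + c'"
  have "a + a' + (d + d') = (a + d) + (a' + d')" by (simp add: ac_simps)
  then show "a + a' + (d + d') = b + b' + (c + c')" unfolding 1 2 by (simp add: ac_simps)
qed

lift_definition uminus_virt :: "'a virt \<Rightarrow> 'a virt"
  is "\<lambda>(F, G). (G, F)"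
  by clarsimp

lift_definition minus_virt :: "'a virt \<Rightarrow> 'a virt \<Rightarrow> 'a virt"
  is "\<lambda>(F, G) (H, K). (F + K, G + H)"
proof clarsimp
  fix a b c d a' b' c' d' :: "'a spe"
  assume 1: "a + d = b + c" and 2: "a' + d' = b' + c'"
  have "a + b' + (d + c') = (a + d) + (b' + c')" by (simp add: ac_simps)
  then show "a + b' + (d + c') = b + a' + (c + d')" unfolding 1 2[symmetric] by (simp add: ac_simps)
qed

lift_definition times_virt :: "'a virt \<Rightarrow> 'a virt \<Rightarrow> 'a virt"
  is "\<lambda>(F, G) (H, K). (F * H + G * K, F * K + G * H)"
proof (unfold virt_eq_def, clarify)
  fix s t u v w x y z :: "'a spe"
  assume 1: "s + v = t + u" and 2: "w + z = x + y"
  have "(s * w + t * x + (u * z + v * y)) + (v * w + u * x) = (s + v) * w + (t + u) * x + u * z + v * y"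
    by (simp add: algebra_simps)
  also have "\<dots> = (t + u) * w + (s + v) * x + u * z + v * y"
    by (simp only: 1)
  also have "\<dots> = t * w + s * x + u * (w + z) + v * (x + y)"
    by (simp add: algebra_simps)
  also have "\<dots> = t * w + s * x + u * (x + y) + v * (w + z)"
    by (simp only: 2)
  also have "\<dots> = (s * x + t * w + (u * y + v * z)) + (v * w + u * x)"
    by (simp add: algebra_simps)
  finally show "s * w + t * x + (u * z + v * y) = s * x + t * w + (u * y + v * z)"
    by (simp only: spe_add_right_cancel)
qed

instance
  by standard (transfer; clarsimp simp: algebra_simps)+

end

text \<open>The embedding \<open>F \<mapsto> F - 0\<close>.\<close>

lift_definition virt_of_spe :: "'a spe \<Rightarrow> 'a virt" is "\<lambda>F. (F, 0)" .

definition virt_of :: "('a, 's) species \<Rightarrow> 'a virt" where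
  "virt_of F = virt_of_spe (spe_of F)"

lemma virt_of_eq_iff: "virt_of F = virt_of G \<longleftrightarrow> species_iso F G"
  unfolding virt_of_def spe_of_eq_iff[symmetric] by transfer simp

lemma virt_of_sum: "virt_of (species_sum F G) = virt_of F + virt_of G"
  unfolding virt_of_def spe_of_sum by transfer simp

lemma virt_of_prod: "virt_of (species_prod F G) = virt_of F * virt_of G"
  unfolding virt_of_def spe_of_prod by transfer simp

lemma virt_of_zero: "virt_of zero_species = 0"
  unfolding virt_of_def zero_spe_def[symmetric] by transfer simp

lemma virt_of_one: "virt_of one_species = 1"
  unfolding virt_of_def one_spe_def[symmetric] by transfer simp

lift_definition virt_part :: "nat \<Rightarrow> 'a virt \<Rightarrow> 'a virt"
  is "\<lambda>n (F, G). (spe_part n F, spe_part n G)"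
  by (clarsimp simp flip: spe_part_add)

text \<open>
  Summability and infinite sums: on sets of each given size only finitely many summands are
  nonzero virtual species, and there the sum is their (finite) sum.
\<close>

definition virt_sums :: "(nat \<Rightarrow> 'a virt) \<Rightarrow> 'a virt \<Rightarrow> bool" (infixr "virt'_sums" 80) where
  "f virt_sums \<Phi> \<longleftrightarrow>
     (\<forall>n. finite {m. virt_part n (f m) \<noteq> 0} \<and>
          virt_part n \<Phi> = (\<Sum>m | virt_part n (f m) \<noteq> 0. virt_part n (f m)))"

lemma virt_eq_parts:
  assumes "\<And>n. virt_part n \<Phi> = virt_part n \<Psi>" shows "\<Phi> = \<Psi>"
  using assms
proof (transfer, clarsimp simp flip: spe_part_add)
  fix a b c d :: "'a spe"
  assume "\<And>n. spe_part n (a + d) = spe_part n (b + c)"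
  then show "a + d = b + c" by (rule spe_eq_parts)
qed

lemma virt_sums_unique: "f virt_sums \<Phi> \<Longrightarrow> f virt_sums \<Psi> \<Longrightarrow> \<Phi> = \<Psi>"
  unfolding virt_sums_def by (rule virt_eq_parts) simp


subsection \<open>The inverse of the species of sets\<close>

definition mult_inverse :: "'b :: comm_ring_1 \<Rightarrow> 'b" where
  "mult_inverse x = (THE y. x * y = 1)"

lemma mult_inverse_eqI:
  assumes "x * y = (1 :: 'b :: comm_ring_1)" shows "mult_inverse x = y"
  unfolding mult_inverse_def
proof (rule the_equality)
  fix z assume "x * z = 1"
  then have "y = (x * z) * y" by simp
  also have "\<dots> = (x * y) * z" by (simp add: ac_simps)
  finally show "z = y" using assms by simp
qed (fact assms)

definition E_inv :: "'a virt" where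
  "E_inv = mult_inverse (virt_of set_species)"


text \<open>
  The inverse exists: it is the species of ballots (lists of disjoint nonempty blocks with union
  \<open>U\<close>) of even length minus that of ballots of odd length.
\<close>

primrec is_ballot :: "'a set \<Rightarrow> 'a set list \<Rightarrow> bool" where
  "is_ballot U [] \<longleftrightarrow> U = {}"
| "is_ballot U (A # L) \<longleftrightarrow> A \<noteq> {} \<and> A \<subseteq> U \<and> is_ballot (U - A) L"

lemma is_ballot_bounds: "finite U \<Longrightarrow> is_ballot U L \<Longrightarrow> set L \<subseteq> Pow U \<and> length L \<le> card U"
proof (induction L arbitrary: U)
  case (Cons A L)
  then have "set L \<subseteq> Pow (U - A)" "length L \<le> card (U - A)" by auto
  moreover have "card (U - A) < card U"
    using Cons.prems by (intro psubset_card_mono) auto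
  ultimately show ?case using Cons.prems by auto
qed simp

lemma is_ballot_map: "is_ballot U L \<Longrightarrow> inj_on \<sigma> U \<Longrightarrow> is_ballot (\<sigma> ` U) (map ((`) \<sigma>) L)"
proof (induction L arbitrary: U)
  case (Cons A L)
  then have "is_ballot (\<sigma> ` (U - A)) (map ((`) \<sigma>) L)"
    by (simp add: inj_on_diff)
  moreover have "\<sigma> ` (U - A) = \<sigma> ` U - \<sigma> ` A"
    using Cons.prems by (intro inj_on_image_set_diff[of \<sigma> U]) auto
  ultimately show ?case using Cons.prems by auto
qed simp

definition ballots :: "bool \<Rightarrow> ('a, 'a set list) species" where
  "ballots p = mk_species (\<lambda>U. {L. is_ballot U L \<and> even (length L) = p}) (\<lambda>U \<sigma>. map ((`) \<sigma>))"

lemma ballots [simp]: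
  "structs (ballots p) = (\<lambda>U. {L. is_ballot U L \<and> even (length L) = p})"
  "transport (ballots p) = (\<lambda>U \<sigma>. map ((`) \<sigma>))"
proof -
  have *: "species_functor (\<lambda>U. {L. is_ballot U L \<and> even (length L) = p}) (\<lambda>U \<sigma>. map ((`) \<sigma>))"
  proof (rule species_functorI, goal_cases)
    case (1 U)
    have "{L. is_ballot U L \<and> even (length L) = p} \<subseteq> {L. set L \<subseteq> Pow U \<and> length L \<le> card U}"
      using is_ballot_bounds[OF 1] by blast
    then show ?case
      by (rule finite_subset) (simp add: finite_lists_length_le 1)
  next
    case (2 U V \<sigma> s)
    then show ?case using is_ballot_map[of U s \<sigma>] by (auto simp: bij_betw_def)
  next
    case (3 U V \<sigma> \<sigma>' s)
    have "set s \<subseteq> Pow U" using is_ballot_bounds[OF 3(1)] 3(4) by blast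
    then show ?case using 3(3) by (intro map_cong refl image_cong) auto
  next
    case (4 U s)
    then show ?case by (simp add: map_idI)
  next
    case (5 U V W \<sigma> \<tau> s)
    then show ?case by (simp add: image_comp)
  qed
  show "structs (ballots p) = (\<lambda>U. {L. is_ballot U L \<and> even (length L) = p})"
    "transport (ballots p) = (\<lambda>U \<sigma>. map ((`) \<sigma>))"
    unfolding ballots_def by (rule mk_species[OF *])+
qed

lemma species_prod_mem:
  "((A, B), (s, t)) \<in> structs (species_prod F G) U \<longleftrightarrow>
     U = A \<union> B \<and> A \<inter> B = {} \<and> s \<in> structs F A \<and> t \<in> structs G B"
  by simp

lemma ballots_odd: "species_iso (ballots False) (species_prod nonempty_set_species (ballots True))"
proof (rule species_iso_witness[of _ "\<lambda>U L. ((hd L, U - hd L), ((), tl L))"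
      _ "\<lambda>_ ((A, _), (_, L)). A # L"], goal_cases)
  case (1 U s)
  then show ?case by (cases s) (auto simp: species_prod_mem Un_absorb1 simp del: species_prod(1) split: if_splits)
next
  case (2 U t) then show ?case by (auto simp: Un_Diff Diff_triv Int_commute split: if_splits)
next
  case (3 U V \<sigma> s)
  then show ?case
    by (cases s) (auto simp: bij_betw_def inj_on_image_set_diff[of \<sigma> U])
qed

lemma ballots_even:
  "species_iso (ballots True) (species_sum one_species (species_prod nonempty_set_species (ballots False)))"
proof (rule species_iso_witness[of _
      "\<lambda>U L. if L = [] then Inl () else Inr ((hd L, U - hd L), ((), tl L))"
      _ "\<lambda>_. case_sum (\<lambda>_. []) (\<lambda>((A, _), (_, L)). A # L)"], goal_cases)
  case (1 U s)
  then show ?case by (cases s) (auto simp: species_prod_mem Un_absorb1 simp del: species_prod(1) split: if_splits)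
next
  case (2 U t) then show ?case by (auto simp: Un_Diff Diff_triv Int_commute split: if_splits)
next
  case (3 U V \<sigma> s)
  then show ?case
    by (cases s) (auto simp: bij_betw_def inj_on_image_set_diff[of \<sigma> U])
qed

lemma set_species_decomp: "species_iso set_species (species_sum one_species nonempty_set_species)"
  by (rule species_iso_witness[of _ "\<lambda>U _. if U = {} then Inl () else Inr ()" _ "\<lambda>_ _. ()"])
    (auto split: if_splits simp: bij_betw_def)

lemma E_inv: "virt_of set_species * E_inv = (1 :: 'a virt)"
proof -
  let ?P = "virt_of nonempty_set_species :: 'a virt"
  let ?B = "virt_of (ballots True) :: 'a virt" and ?C = "virt_of (ballots False) :: 'a virt"
  have E: "virt_of set_species = 1 + ?P"
    by (metis set_species_decomp virt_of_eq_iff virt_of_sum virt_of_one)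
  have C: "?C = ?P * ?B"
    by (metis ballots_odd virt_of_eq_iff virt_of_prod)
  have B: "?B = 1 + ?P * ?C"
    by (metis ballots_even virt_of_eq_iff virt_of_prod virt_of_sum virt_of_one)
  have "virt_of set_species * (?B - ?C) = ?B - ?P * ?C + (?P * ?B - ?C)"
    unfolding E by (simp add: algebra_simps)
  also have "?B - ?P * ?C = 1"
    using B by (metis add_diff_cancel_right')
  also have "1 + (?P * ?B - ?C) = 1"
    by (simp only: C diff_self add_0_right)
  finally show ?thesis
    unfolding E_inv_def by (simp add: mult_inverse_eqI)
qed


section \<open>Interval orders\<close>

text \<open>A poset is given by its underlying set together with its strict order relation.\<close>

definition poset_on :: "'a set \<Rightarrow> ('a \<times> 'a) set \<Rightarrow> bool" where
  "poset_on U P \<longleftrightarrow> P \<subseteq> U \<times> U \<and> irrefl P \<and> trans P"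

definition poset_iso :: "'a set \<Rightarrow> ('a \<times> 'a) set \<Rightarrow> 'b set \<Rightarrow> ('b \<times> 'b) set \<Rightarrow> bool" where
  "poset_iso A P B Q \<longleftrightarrow>
     (\<exists>f. bij_betw f A B \<and> (\<forall>x\<in>A. \<forall>y\<in>A. (x, y) \<in> P \<longleftrightarrow> (f x, f y) \<in> Q))"

definition two_plus_two :: "(nat \<times> nat) set" where
  "two_plus_two = {(0, 1), (2, 3)}"

definition two_plus_two_free :: "'a set \<Rightarrow> ('a \<times> 'a) set \<Rightarrow> bool" where
  "two_plus_two_free U P \<longleftrightarrow>
     \<not> (\<exists>W\<subseteq>U. poset_iso W (P \<inter> W \<times> W) {0, 1, 2, 3} two_plus_two)"

definition interval_orders :: "('a, ('a \<times> 'a) set) species" where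
  "interval_orders = mk_species
     (\<lambda>U. {P. poset_on U P \<and> two_plus_two_free U P})
     (\<lambda>U \<sigma> P. map_prod \<sigma> \<sigma> ` P)"

lemma poset_iso_image:
  assumes "inj_on \<sigma> U" "W \<subseteq> U" "P \<subseteq> U \<times> U"
  shows "poset_iso (\<sigma> ` W) (map_prod \<sigma> \<sigma> ` P \<inter> \<sigma> ` W \<times> \<sigma> ` W) B Q \<longleftrightarrow> poset_iso W (P \<inter> W \<times> W) B Q"
    (is "?l \<longleftrightarrow> ?r")
proof -
  have b: "bij_betw \<sigma> W (\<sigma> ` W)"
    using assms inj_on_subset by (auto simp: bij_betw_def)
  have mem: "(\<sigma> x, \<sigma> y) \<in> map_prod \<sigma> \<sigma> ` P \<longleftrightarrow> (x, y) \<in> P" if "x \<in> U" "y \<in> U" for x y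
  proof
    assume "(\<sigma> x, \<sigma> y) \<in> map_prod \<sigma> \<sigma> ` P"
    then obtain x' y' where *: "(x', y') \<in> P" "\<sigma> x' = \<sigma> x" "\<sigma> y' = \<sigma> y" by auto
    then have "x' = x" "y' = y"
      using assms(3) that inj_onD[OF assms(1), of x' x] inj_onD[OF assms(1), of y' y] by auto
    with * show "(x, y) \<in> P" by simp
  qed force
  show ?thesis
  proof
    assume ?l
    then obtain f where f: "bij_betw f (\<sigma> ` W) B"
      "\<forall>x\<in>\<sigma> ` W. \<forall>y\<in>\<sigma> ` W. (x, y) \<in> map_prod \<sigma> \<sigma> ` P \<inter> \<sigma> ` W \<times> \<sigma> ` W \<longleftrightarrow> (f x, f y) \<in> Q"
      unfolding poset_iso_def by blast
    show ?r
      unfolding poset_iso_def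
    proof (intro exI[of _ "f \<circ> \<sigma>"] conjI ballI)
      show "bij_betw (f \<circ> \<sigma>) W B" using bij_betw_trans[OF b f(1)] .
      fix x y assume xy: "x \<in> W" "y \<in> W"
      have "(\<sigma> x, \<sigma> y) \<in> map_prod \<sigma> \<sigma> ` P \<longleftrightarrow> (f (\<sigma> x), f (\<sigma> y)) \<in> Q"
        using f(2)[rule_format, of "\<sigma> x" "\<sigma> y"] xy by simp
      then show "(x, y) \<in> P \<inter> W \<times> W \<longleftrightarrow> ((f \<circ> \<sigma>) x, (f \<circ> \<sigma>) y) \<in> Q"
        using mem[of x y] xy assms(2) by auto
    qed
  next
    assume ?r
    then obtain f where f: "bij_betw f W B"
      "\<forall>x\<in>W. \<forall>y\<in>W. (x, y) \<in> P \<inter> W \<times> W \<longleftrightarrow> (f x, f y) \<in> Q"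
      unfolding poset_iso_def by blast
    have inv: "inv_into W \<sigma> (\<sigma> x) = x" if "x \<in> W" for x
      using b that by (rule bij_betw_inv_into_left)
    show ?l
      unfolding poset_iso_def
    proof (intro exI[of _ "f \<circ> inv_into W \<sigma>"] conjI ballI)
      show "bij_betw (f \<circ> inv_into W \<sigma>) (\<sigma> ` W) B"
        using bij_betw_trans[OF bij_betw_inv_into[OF b] f(1)] .
      fix x' y' assume "x' \<in> \<sigma> ` W" "y' \<in> \<sigma> ` W"
      then obtain x y where xy: "x \<in> W" "y \<in> W" "x' = \<sigma> x" "y' = \<sigma> y" by blast
      then have "(x, y) \<in> P \<longleftrightarrow> (f x, f y) \<in> Q"
        using f(2)[rule_format, of x y] by simp
      then show "(x', y') \<in> map_prod \<sigma> \<sigma> ` P \<inter> \<sigma> ` W \<times> \<sigma> ` W \<longleftrightarrow>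
          ((f \<circ> inv_into W \<sigma>) x', (f \<circ> inv_into W \<sigma>) y') \<in> Q"
        using mem[of x y] xy(1,2) subsetD[OF assms(2)] inv[OF xy(1)] inv[OF xy(2)]
        unfolding xy(3,4) by simp
    qed
  qed
qed

lemma interval_order_image:
  assumes inj: "inj_on \<sigma> U" and P: "poset_on U P" and free: "two_plus_two_free U P"
  shows "poset_on (\<sigma> ` U) (map_prod \<sigma> \<sigma> ` P)" "two_plus_two_free (\<sigma> ` U) (map_prod \<sigma> \<sigma> ` P)"
proof -
  have sub: "P \<subseteq> U \<times> U" "irrefl P" "trans P" using P by (auto simp: poset_on_def)
  have "irrefl (map_prod \<sigma> \<sigma> ` P)"
  proof (rule irreflI, rule notI)
    fix a assume "(a, a) \<in> map_prod \<sigma> \<sigma> ` P"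
    then obtain x y where xy: "(x, y) \<in> P" "\<sigma> x = a" "\<sigma> y = a" by auto
    then have "x = y" using sub(1) inj_onD[OF inj, of x y] by auto
    with xy sub(2) show False by (simp add: irrefl_def)
  qed
  moreover have "trans (map_prod \<sigma> \<sigma> ` P)"
  proof (rule transI)
    fix a b c assume "(a, b) \<in> map_prod \<sigma> \<sigma> ` P" "(b, c) \<in> map_prod \<sigma> \<sigma> ` P"
    then obtain x y y' z where xy: "(x, y) \<in> P" "(y', z) \<in> P" "a = \<sigma> x" "b = \<sigma> y" "b = \<sigma> y'" "c = \<sigma> z"
      by auto
    then have "y = y'" using sub(1) inj_onD[OF inj, of y y'] by auto
    with xy sub(3) have "(x, z) \<in> P" by (auto dest: transD)
    with xy show "(a, c) \<in> map_prod \<sigma> \<sigma> ` P" by force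
  qed
  ultimately show "poset_on (\<sigma> ` U) (map_prod \<sigma> \<sigma> ` P)"
    using sub(1) by (auto simp: poset_on_def)
  show "two_plus_two_free (\<sigma> ` U) (map_prod \<sigma> \<sigma> ` P)"
    unfolding two_plus_two_free_def
  proof (rule notI, elim exE conjE)
    fix W' assume "W' \<subseteq> \<sigma> ` U"
      and iso: "poset_iso W' (map_prod \<sigma> \<sigma> ` P \<inter> W' \<times> W') {0, 1, 2, 3} two_plus_two"
    then obtain W where W: "W \<subseteq> U" "W' = \<sigma> ` W" by (auto simp: subset_image_iff)
    with iso have "poset_iso W (P \<inter> W \<times> W) {0, 1, 2, 3} two_plus_two"
      using poset_iso_image[OF inj W(1) sub(1), of "{0, 1, 2, 3}" two_plus_two] by simp
    with free W(1) show False by (auto simp: two_plus_two_free_def)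
  qed
qed

lemma interval_orders [simp]:
  "structs interval_orders = (\<lambda>U. {P. poset_on U P \<and> two_plus_two_free U P})"
  "transport interval_orders = (\<lambda>U \<sigma> P. map_prod \<sigma> \<sigma> ` P)"
proof -
  have *: "species_functor (\<lambda>U. {P. poset_on U P \<and> two_plus_two_free U P})
    (\<lambda>U \<sigma> P. map_prod \<sigma> \<sigma> ` P)"
  proof (rule species_functorI, goal_cases)
    case (1 U)
    have "{P. poset_on U P \<and> two_plus_two_free U P} \<subseteq> Pow (U \<times> U)"
      by (auto simp: poset_on_def)
    then show ?case by (rule finite_subset) (simp add: 1)
  next
    case (2 U V \<sigma> P)
    then show ?case using interval_order_image[of \<sigma> U P] by (auto simp: bij_betw_def)
  next
    case (3 U V \<sigma> \<sigma>' P)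
    then have "P \<subseteq> U \<times> U" by (simp add: poset_on_def)
    then show ?case using 3(3) by (intro image_cong refl) auto
  next
    case (4 U P)
    then show ?case by (simp add: prod.map_id)
  next
    case (5 U V W \<sigma> \<tau> P)
    then show ?case by (simp add: image_image map_prod_def case_prod_beta)
  qed
  show "structs interval_orders = (\<lambda>U. {P. poset_on U P \<and> two_plus_two_free U P})"
    "transport interval_orders = (\<lambda>U \<sigma> P. map_prod \<sigma> \<sigma> ` P)"
    unfolding interval_orders_def by (rule mk_species[OF *])+
qed

end

theory Submission
  imports Defs
begin

text \<open>
  Write \<open>q = E\<^sup>-\<^sup>1\<close> and \<open>Y = E - 1\<close>, the species of nonempty sets.  The \<open>m\<close>-th term of the series is
  \<open>(1 - q) (1 - q\<^sup>2) \<dots> (1 - q\<^sup>m)\<close>.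

  An interval order has a unique representation by intervals \<open>[l x, r x]\<close> with \<open>x < y\<close> iff
  \<open>r x < l y\<close> in which \<open>l\<close> and \<open>r\<close> have the same image \<open>{..<m}\<close>: take \<open>l x\<close> to be the rank of
  the down-set of \<open>x\<close> in the chain of all down-sets \<open>{y. y < z}\<close> (they form a chain because there is no
  \<open>2+2\<close>), and \<open>r x + 1\<close> to be the number of down-sets that avoid \<open>x\<close>
  (\<open>interval_rep_exists\<close>, \<open>interval_rep_unique\<close>).  So an interval order is the same as a
  colouring \<open>x \<mapsto> (r x, l x)\<close> whose set of colours \<open>T\<close> is the support of a Fishburn matrix: a
  triangular shape with no empty row and no empty column.  Colourings that use exactly the colours
  in \<open>T\<close> form the species \<open>Y\<^bsup>|T|\<^esup>\<close> (\<open>virt_of_colourings\<close>).  These bijections commute with transport,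
  so in \<open>Virt\<close> the species of interval orders is the sum of \<open>Y\<^bsup>|T|\<^esup>\<close> over all Fishburn supports \<open>T\<close>
  (\<open>virt_part_interval_orders\<close>).

  What remains holds in every commutative ring in which \<open>1 + Y = E\<close> has the inverse \<open>q\<close>.
  Inclusion-exclusion over the set \<open>S\<close> of columns in use removes the condition on the columns, and
  then the rows are independent: a row with \<open>k\<close> available columns contributes \<open>E\<^sup>k - 1\<close>
  (\<open>sum_fishburn\<close>).  Peeling off the last row relates sieve sums of size \<open>m + 1\<close> to those of size \<open>m\<close>,
  and for a suitable weight the sum over all \<open>m \<le> N\<close> telescopes to the partial sum
  of the series, up to one sieve sum of size \<open>N + 1\<close> (\<open>sum_sieve\<close>).  Every factor \<open>E\<^sup>k - 1\<close> is a
  virtual species without structures on the empty set, so this remainder vanishes on sets with at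
  most \<open>N\<close> elements, and so does the rest of the series.
\<close>

section \<open>Fishburn supports and a telescoping sieve\<close>

lemma sum_power_card_Pow:
  fixes Y :: "'r :: comm_ring_1"
  assumes "finite A"
  shows "(\<Sum>T\<in>Pow A. Y ^ card T) = (1 + Y) ^ card A"
  using prod_add[OF assms, of "\<lambda>_. Y" "\<lambda>_. 1"] by (simp add: add.commute)

text \<open>
  Both sides are Moebius inverses, over the subsets \<open>J\<close> of \<open>I\<close>, of
  \<open>J \<mapsto> \<Prod>i\<in>J. (1 + Y) ^ card (C i)\<close>, which is the generating function of all subsets of
  \<open>Sigma J C\<close>.
\<close>

lemma sum_full_rows:
  fixes Y :: "'r :: comm_ring_1"
  assumes I: "finite I" and C: "\<And>i. finite (C i)"
  shows "(\<Sum>T | T \<subseteq> Sigma I C \<and> fst ` T = I. Y ^ card T) = (\<Prod>i\<in>I. (1 + Y) ^ card (C i) - 1)"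
proof -
  define f where "f J = (\<Sum>T | T \<subseteq> Sigma J C \<and> fst ` T = J. Y ^ card T)" for J
  have g: "(\<Prod>i\<in>J. (1 + Y) ^ card (C i)) = sum f (Pow J)" if J: "finite J" for J
  proof -
    have "(\<Prod>i\<in>J. (1 + Y) ^ card (C i)) = (1 + Y) ^ card (Sigma J C)"
      using J C by (simp add: card_SigmaI power_sum)
    also have "\<dots> = (\<Sum>T\<in>Pow (Sigma J C). Y ^ card T)"
      using J C by (simp add: sum_power_card_Pow)
    also have "\<dots> = (\<Sum>K\<in>Pow J. \<Sum>T | T \<in> Pow (Sigma J C) \<and> fst ` T = K. Y ^ card T)"
      using J C by (intro sum.group[symmetric]) auto
    also have "\<dots> = sum f (Pow J)"
    proof (rule sum.cong[OF refl])
      fix K assume "K \<in> Pow J"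
      then have "{T. T \<in> Pow (Sigma J C) \<and> fst ` T = K} = {T. T \<subseteq> Sigma K C \<and> fst ` T = K}"
        by force
      then show "(\<Sum>T | T \<in> Pow (Sigma J C) \<and> fst ` T = K. Y ^ card T) = f K"
        by (simp add: f_def)
    qed
    finally show ?thesis .
  qed
  have "f I = (\<Sum>J\<in>Pow I. (-1) ^ (card I - card J) * (\<Prod>i\<in>J. (1 + Y) ^ card (C i)))"
    by (rule inclusion_exclusion_mobius[OF g I])
  also have "\<dots> = (\<Prod>i\<in>I. (1 + Y) ^ card (C i) - 1)"
    using prod_diff_conv_sum'[OF I, of "\<lambda>i. (1 + Y) ^ card (C i)" "\<lambda>_. 1"] by simp
  finally show ?thesis by (simp add: f_def)
qed

text \<open>
  The possible sets of nonzero positions of a triangular matrix of size \<open>m\<close> without zero rows and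
  columns.  Pairs are (row, column), and row \<open>i\<close> extends over the columns up to \<open>i\<close>, so
  that rows grow with their index and the last one can be removed without renumbering.
\<close>

definition fishburn :: "nat \<Rightarrow> (nat \<times> nat) set set" where
  "fishburn m = {T. T \<subseteq> Sigma {..<m} (\<lambda>i. {..i}) \<and> fst ` T = {..<m} \<and> snd ` T = {..<m}}"

lemma finite_fishburn: "finite (fishburn m)" "T \<in> fishburn m \<Longrightarrow> finite T"
proof -
  have fin: "finite (Sigma {..<m} (\<lambda>i. {..i}))" by simp
  show "finite (fishburn m)"
    by (rule finite_subset[of _ "Pow (Sigma {..<m} (\<lambda>i. {..i}))"]) (auto simp: fishburn_def)
  show "finite T" if "T \<in> fishburn m"
    using that by (intro finite_subset[OF _ fin]) (simp add: fishburn_def)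
qed

text \<open>
  The inclusion-exclusion sum over the set \<open>S\<close> of columns in use, with a weight \<open>h\<close> that depends on
  the number of these columns.  The weight \<open>1\<close> enumerates Fishburn supports; general weights
  are needed for a recursion in \<open>m\<close>.
\<close>

definition sieve :: "'r :: comm_ring_1 \<Rightarrow> nat \<Rightarrow> (nat \<Rightarrow> 'r) \<Rightarrow> 'r" where
  "sieve E m h = (\<Sum>S\<in>Pow {..<m}.
     (-1) ^ (m - card S) * (\<Prod>i<m. E ^ card ({..i} \<inter> S) - 1) * h (card S))"

text \<open>
  Dropping the condition that every column is used and allowing only the columns in \<open>S\<close> gives a sum to
  which \<open>sum_full_rows\<close> applies; inclusion-exclusion over \<open>S\<close> restores the condition.
\<close>

lemma sum_fishburn:
  fixes Y :: "'r :: comm_ring_1"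
  shows "(\<Sum>T\<in>fishburn m. Y ^ card T) = sieve (1 + Y) m (\<lambda>_. 1)"
proof -
  let ?full = "\<lambda>T. T \<subseteq> Sigma {..<m} (\<lambda>i. {..i}) \<and> fst ` T = {..<m}"
  define f where "f S = (\<Sum>T | ?full T \<and> snd ` T = S. Y ^ card T)" for S
  have fin: "finite {T. ?full T}"
    by (rule finite_subset[of _ "Pow (Sigma {..<m} (\<lambda>i. {..i}))"]) auto
  have g: "(\<Prod>i<m. (1 + Y) ^ card ({..i} \<inter> S) - 1) = sum f (Pow S)" if "finite S" for S
  proof -
    have "(\<Prod>i<m. (1 + Y) ^ card ({..i} \<inter> S) - 1) =
        (\<Sum>T | T \<subseteq> Sigma {..<m} (\<lambda>i. {..i} \<inter> S) \<and> fst ` T = {..<m}. Y ^ card T)"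
      by (rule sum_full_rows[symmetric]) auto
    also have "{T. T \<subseteq> Sigma {..<m} (\<lambda>i. {..i} \<inter> S) \<and> fst ` T = {..<m}} =
        {T. ?full T \<and> snd ` T \<subseteq> S}"
    proof (rule Collect_cong)
      fix T
      have "T \<subseteq> Sigma {..<m} (\<lambda>i. {..i} \<inter> S) \<longleftrightarrow> T \<subseteq> Sigma {..<m} (\<lambda>i. {..i}) \<and> snd ` T \<subseteq> S"
        unfolding image_subset_iff subset_iff by auto
      then show "T \<subseteq> Sigma {..<m} (\<lambda>i. {..i} \<inter> S) \<and> fst ` T = {..<m} \<longleftrightarrow> ?full T \<and> snd ` T \<subseteq> S"
        by (simp only: conj_ac)
    qed
    also have "(\<Sum>T | ?full T \<and> snd ` T \<subseteq> S. Y ^ card T) =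
        (\<Sum>K\<in>Pow S. \<Sum>T | T \<in> {T. ?full T \<and> snd ` T \<subseteq> S} \<and> snd ` T = K. Y ^ card T)"
      using that by (intro sum.group[symmetric] finite_subset[OF _ fin]) auto
    also have "\<dots> = sum f (Pow S)"
    proof (rule sum.cong[OF refl])
      fix K assume "K \<in> Pow S"
      then have "{T. T \<in> {T. ?full T \<and> snd ` T \<subseteq> S} \<and> snd ` T = K} = {T. ?full T \<and> snd ` T = K}"
        by auto
      then show "(\<Sum>T | T \<in> {T. ?full T \<and> snd ` T \<subseteq> S} \<and> snd ` T = K. Y ^ card T) = f K"
        by (simp add: f_def)
    qed
    finally show ?thesis .
  qed
  have "f {..<m} = sieve (1 + Y) m (\<lambda>_. 1)"
    unfolding sieve_def using inclusion_exclusion_mobius[of _ f, OF g, of "{..<m}"] by simp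
  then show ?thesis
    by (simp add: f_def fishburn_def conj_assoc)
qed

lemma sieve_0 [simp]: "sieve E 0 h = h 0"
  by (simp add: sieve_def)

lemma sieve_cong:
  assumes "\<And>s. s \<le> m \<Longrightarrow> h s = h' s" shows "sieve E m h = sieve E m h'"
  unfolding sieve_def
proof (intro sum.cong refl)
  fix S assume "S \<in> Pow {..<m}"
  then have "card S \<le> m" using card_mono[of "{..<m}" S] by auto
  then show "(-1) ^ (m - card S) * (\<Prod>i<m. E ^ card ({..i} \<inter> S) - 1) * h (card S) =
      (-1) ^ (m - card S) * (\<Prod>i<m. E ^ card ({..i} \<inter> S) - 1) * h' (card S)"
    using assms by simp
qed

lemma sieve_diff: "sieve E m (\<lambda>s. h s - h' s) = sieve E m h - sieve E m h'"
  by (simp add: sieve_def sum_subtractf right_diff_distrib)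

text \<open>
  Split off the last row.  All columns in use are available to it, since the column with the same index occurs
  in no other row; that column is either unused (and the sign changes) or used.
\<close>

lemma sieve_Suc:
  "sieve E (Suc m) h = sieve E m (\<lambda>s. (E ^ Suc s - 1) * h (Suc s) - (E ^ s - 1) * h s)"
proof -
  let ?t = "\<lambda>S. (-1) ^ (Suc m - card S) * (\<Prod>i<Suc m. E ^ card ({..i} \<inter> S) - 1) * h (card S)"
  let ?u = "\<lambda>S. (-1) ^ (m - card S) * (\<Prod>i<m. E ^ card ({..i} \<inter> S) - 1)"
  have "sieve E (Suc m) h = sum ?t (Pow {..<m}) + sum ?t (insert m ` Pow {..<m})"
    unfolding sieve_def lessThan_Suc Pow_insert by (rule sum.union_disjoint) auto
  also have "sum ?t (insert m ` Pow {..<m}) = (\<Sum>S\<in>Pow {..<m}. ?t (insert m S))"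
    by (subst sum.reindex) (auto intro!: inj_onI simp: o_def)
  also have "sum ?t (Pow {..<m}) = (\<Sum>S\<in>Pow {..<m}. ?u S * - ((E ^ card S - 1) * h (card S)))"
  proof (rule sum.cong[OF refl])
    fix S assume S: "S \<in> Pow {..<m}"
    then have "card S \<le> m" using card_mono[of "{..<m}" S] by auto
    moreover have "{..m} \<inter> S = S" using S by auto
    ultimately show "?t S = ?u S * - ((E ^ card S - 1) * h (card S))"
      by (simp add: Suc_diff_le mult_ac)
  qed
  also have "(\<Sum>S\<in>Pow {..<m}. ?t (insert m S)) =
      (\<Sum>S\<in>Pow {..<m}. ?u S * ((E ^ Suc (card S) - 1) * h (Suc (card S))))"
  proof (rule sum.cong[OF refl])
    fix S assume S: "S \<in> Pow {..<m}"
    then have fin: "finite S" "m \<notin> S" by (auto intro: finite_subset)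
    have "{..m} \<inter> insert m S = insert m S" using S by auto
    moreover have "(\<Prod>i<m. E ^ card ({..i} \<inter> insert m S) - 1) = (\<Prod>i<m. E ^ card ({..i} \<inter> S) - 1)"
      by (rule prod.cong) auto
    ultimately show "?t (insert m S) = ?u S * ((E ^ Suc (card S) - 1) * h (Suc (card S)))"
      using fin by (simp add: mult_ac)
  qed
  finally show ?thesis
    unfolding sieve_def sum.distrib[symmetric] by (simp add: algebra_simps)
qed

text \<open>
  By \<open>sieve_Suc\<close>, passing from size \<open>m\<close> to \<open>m + 1\<close> acts on the weight \<open>h\<close> by
  \<open>(L h) s = (E ^ Suc s - 1) * h (Suc s) - (E ^ s - 1) * h s\<close>.  The sum telescopes once \<open>1\<close> is written
  as \<open>G - L G\<close>.  With \<open>H s = E ^ s * G s\<close> this equation becomes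
  \<open>H s = 1 + (1 - q ^ Suc s) * H (Suc s)\<close>, whose iteration from \<open>s = 0\<close> produces the terms of the
  series.  Cutting the iteration off after \<open>N\<close> makes \<open>H\<close> a finite sum, and the equation is still valid
  for \<open>s \<le> N\<close>, the only values that sieve sums of size at most \<open>N\<close> see.
\<close>

lemma sum_sieve:
  fixes E q :: "'r :: comm_ring_1"
  assumes q: "E * q = 1"
  obtains G where "(\<Sum>m\<le>N. sieve E m (\<lambda>_. 1)) =
     (\<Sum>t\<le>N. \<Prod>k=1..t. 1 - q ^ k) - sieve E (Suc N) G"
proof
  define H where "H s = (\<Sum>t=s..N. \<Prod>k=Suc s..t. 1 - q ^ k)" for s
  define G where "G s = q ^ s * H s" for s
  have EG: "E ^ s * G s = H s" for s
  proof -
    have "E ^ s * q ^ s = 1" by (simp add: q flip: power_mult_distrib)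
    then show ?thesis by (simp add: G_def flip: mult.assoc)
  qed
  have H: "H s = 1 + (1 - q ^ Suc s) * H (Suc s)" if "s \<le> N" for s
  proof -
    have "H s = (\<Prod>k=Suc s..s. 1 - q ^ k) + (\<Sum>t=Suc s..N. \<Prod>k=Suc s..t. 1 - q ^ k)"
      unfolding H_def using that by (rule sum.atLeast_Suc_atMost)
    also have "(\<Sum>t=Suc s..N. \<Prod>k=Suc s..t. 1 - q ^ k) =
        (\<Sum>t=Suc s..N. (1 - q ^ Suc s) * (\<Prod>k=Suc (Suc s)..t. 1 - q ^ k))"
      by (intro sum.cong refl prod.atLeast_Suc_atMost) simp
    finally show ?thesis by (simp add: H_def sum_distrib_left)
  qed
  have G: "G s - ((E ^ Suc s - 1) * G (Suc s) - (E ^ s - 1) * G s) = 1" if "s \<le> N" for s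
  proof -
    have "G (Suc s) = q ^ Suc s * H (Suc s)" by (simp add: G_def)
    moreover have "G s - ((E ^ Suc s - 1) * G (Suc s) - (E ^ s - 1) * G s) =
        E ^ s * G s - E ^ Suc s * G (Suc s) + G (Suc s)"
      by (simp add: algebra_simps)
    ultimately show ?thesis
      unfolding EG using H[OF that] by (simp add: algebra_simps)
  qed
  have "(\<Sum>m\<le>N. sieve E m (\<lambda>_. 1)) = (\<Sum>m\<le>N. sieve E m G - sieve E (Suc m) G)"
    unfolding sieve_Suc sieve_diff[symmetric] by (intro sum.cong refl sieve_cong) (simp add: G del: power_Suc)
  also have "\<dots> = G 0 - sieve E (Suc N) G"
    using sum_telescope[of "\<lambda>m. sieve E m G" N] by simp
  also have "G 0 = (\<Sum>t\<le>N. \<Prod>k=1..t. 1 - q ^ k)"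
    by (simp add: G_def H_def atLeast0AtMost)
  finally show "(\<Sum>m\<le>N. sieve E m (\<lambda>_. 1)) =
     (\<Sum>t\<le>N. \<Prod>k=1..t. 1 - q ^ k) - sieve E (Suc N) G" .
qed


section \<open>Virtual species without small structures\<close>

lemma spe_part_eq_0_iff:
  "spe_part n (spe_of F :: 'a spe) = 0 \<longleftrightarrow> (\<forall>U. finite U \<longrightarrow> card U = n \<longrightarrow> structs F U = {})"
proof -
  have "spe_part n (spe_of F) = 0 \<longleftrightarrow> species_iso (species_part n F) zero_species"
    by (simp add: spe_part_spe_of zero_spe_def spe_of_eq_iff)
  also have "\<dots> \<longleftrightarrow> (\<forall>U. finite U \<longrightarrow> card U = n \<longrightarrow> structs F U = {})" (is "_ \<longleftrightarrow> ?r")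
  proof
    assume "species_iso (species_part n F) (zero_species :: ('a, unit) species)"
    then obtain \<phi> :: "'a set \<Rightarrow> 'b \<Rightarrow> unit"
      where "\<And>U. finite U \<Longrightarrow> bij_betw (\<phi> U) (structs (species_part n F) U) (structs zero_species U)"
      by (rule species_isoE) (rule that)
    then have "bij_betw (\<phi> U) (structs (species_part n F) U) {}" if "finite U" for U
      using that by simp
    then show ?r by (fastforce simp: bij_betw_def)
  next
    assume ?r
    then show "species_iso (species_part n F) (zero_species :: ('a, unit) species)"
      by (intro species_isoI[of "\<lambda>_ _. ()"]) (auto simp: bij_betw_def split: if_splits)
  qed
  finally show ?thesis .
qed

text \<open>
  A structure of the product on a set with fewer than \<open>d + e\<close> elements would split this set into two
  blocks, one of which is too small to carry a structure.
\<close>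

lemma spe_part_mult_eq_0:
  fixes a b :: "'a spe"
  assumes a: "\<And>i. i < d \<Longrightarrow> spe_part i a = 0" and b: "\<And>i. i < e \<Longrightarrow> spe_part i b = 0"
    and n: "n < d + e"
  shows "spe_part n (a * b) = 0"
proof -
  obtain F :: "('a, nat) species" where F: "a = spe_of F" by (rule spe_cases)
  obtain G :: "('a, nat) species" where G: "b = spe_of G" by (rule spe_cases)
  have "structs (species_prod F G) U = {}" if U: "finite U" "card U = n" for U
  proof -
    have False if "U = A \<union> B" "A \<inter> B = {}" "s \<in> structs F A" "t \<in> structs G B" for A B s t
    proof -
      have fin: "finite A" "finite B" using that U by auto
      then have "card A + card B = n" using that U card_Un_disjoint[of A B] by simp
      with n have "card A < d \<or> card B < e" by linarith
      then show False
        using a b fin that(3,4) unfolding F G spe_part_eq_0_iff by blast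
    qed
    then show ?thesis by auto
  qed
  then show ?thesis
    unfolding F G spe_of_prod[symmetric] spe_part_eq_0_iff by blast
qed

lemma virt_of_spe_add: "virt_of_spe (a + b) = virt_of_spe a + virt_of_spe b"
  by transfer simp

lemma virt_of_spe_mult: "virt_of_spe (a * b) = virt_of_spe a * virt_of_spe b"
  by transfer simp

lemma virt_cases: obtains a b where "x = virt_of_spe a - virt_of_spe b"
proof -
  have "\<exists>a b. x = virt_of_spe a - virt_of_spe b"
  proof (transfer, clarsimp)
    fix a b :: "'a spe"
    show "\<exists>c d. a + d = b + c"
      by (intro exI[of _ a] exI[of _ b]) (rule add.commute)
  qed
  then show thesis using that by blast
qed

lemma virt_part_0: "virt_part n 0 = 0"
  by transfer simp

lemma virt_part_diff: "virt_part n (x - y) = virt_part n x - virt_part n y"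
  by transfer (auto simp: spe_part_add ac_simps)

lemma virt_part_add: "virt_part n (x + y) = virt_part n x + virt_part n y"
  by transfer (auto simp: spe_part_add ac_simps)

lemma virt_part_sum: "virt_part n (sum f A) = (\<Sum>i\<in>A. virt_part n (f i))"
  by (induction A rule: infinite_finite_induct) (simp_all add: virt_part_0 virt_part_add)

lemma spe_part_0: "spe_part n 0 = 0"
  using spe_part_eq_0_iff[of n zero_species] by (simp add: zero_spe_def)

lemma virt_part_virt_of: "virt_part n (virt_of F) = virt_of (species_part n F)"
  unfolding virt_of_def spe_part_spe_of[symmetric] by transfer (simp add: spe_part_0)

text \<open>
  For each \<open>d\<close> these virtual species form an ideal, and the bounds add up under multiplication.
  Asking for one representing pair without structures on fewer than \<open>d\<close> labels, instead of
  asking that the parts of \<open>x\<close> vanish, reduces multiplicativity to species.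
\<close>

definition vanishes_below :: "nat \<Rightarrow> 'a virt \<Rightarrow> bool" where
  "vanishes_below d x \<longleftrightarrow> (\<exists>a b. x = virt_of_spe a - virt_of_spe b \<and>
     (\<forall>n<d. spe_part n a = 0 \<and> spe_part n b = 0))"

lemma vanishes_below_virt_part:
  assumes "vanishes_below d x" "n < d" shows "virt_part n x = 0"
proof -
  obtain a b where x: "x = virt_of_spe a - virt_of_spe b" and "spe_part n a = 0" "spe_part n b = 0"
    using assms by (auto simp: vanishes_below_def)
  moreover have "virt_part n (virt_of_spe c) = virt_of_spe (spe_part n c)" for c :: "'a spe"
    by transfer (simp add: spe_part_0)
  ultimately show ?thesis
    by (simp add: virt_part_diff)
qed

lemma vanishes_below_0: "vanishes_below 0 x"
  by (rule virt_cases[of x]) (auto simp: vanishes_below_def)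

lemma vanishes_below_zero: "vanishes_below d 0"
  unfolding vanishes_below_def by (intro exI[of _ 0]) (simp add: spe_part_0)

lemma vanishes_below_add:
  assumes "vanishes_below d x" "vanishes_below d y" shows "vanishes_below d (x + y)"
proof -
  obtain a b a' b' where "x = virt_of_spe a - virt_of_spe b" "y = virt_of_spe a' - virt_of_spe b'"
    and 0: "\<forall>n<d. spe_part n a = 0 \<and> spe_part n b = 0" "\<forall>n<d. spe_part n a' = 0 \<and> spe_part n b' = 0"
    using assms by (auto simp: vanishes_below_def)
  then have "x + y = virt_of_spe (a + a') - virt_of_spe (b + b')"
    by (simp add: virt_of_spe_add)
  moreover have "\<forall>n<d. spe_part n (a + a') = 0 \<and> spe_part n (b + b') = 0"
    using 0 by (simp add: spe_part_add)
  ultimately show ?thesis unfolding vanishes_below_def by blast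
qed

lemma vanishes_below_mult:
  assumes "vanishes_below d x" "vanishes_below e y" shows "vanishes_below (d + e) (x * y)"
proof -
  obtain a b a' b' where "x = virt_of_spe a - virt_of_spe b" "y = virt_of_spe a' - virt_of_spe b'"
    and 0: "\<forall>n<d. spe_part n a = 0 \<and> spe_part n b = 0" "\<forall>n<e. spe_part n a' = 0 \<and> spe_part n b' = 0"
    using assms by (auto simp: vanishes_below_def)
  then have "x * y = (virt_of_spe a - virt_of_spe b) * (virt_of_spe a' - virt_of_spe b')"
    by simp
  also have "\<dots> = virt_of_spe (a * a' + b * b') - virt_of_spe (a * b' + b * a')"
    by (simp add: virt_of_spe_add virt_of_spe_mult algebra_simps)
  finally have "x * y = virt_of_spe (a * a' + b * b') - virt_of_spe (a * b' + b * a')" .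
  moreover have "\<forall>n<d + e. spe_part n (a * a' + b * b') = 0 \<and> spe_part n (a * b' + b * a') = 0"
    using 0 by (simp add: spe_part_add spe_part_mult_eq_0[of d _ e])
  ultimately show ?thesis unfolding vanishes_below_def by blast
qed

lemma vanishes_below_mult_left: "vanishes_below d x \<Longrightarrow> vanishes_below d (y * x)"
  using vanishes_below_mult[OF vanishes_below_0] by fastforce

lemma vanishes_below_sum:
  "(\<And>i. i \<in> A \<Longrightarrow> vanishes_below d (f i)) \<Longrightarrow> vanishes_below d (sum f A)"
  by (induction A rule: infinite_finite_induct)
    (simp_all add: vanishes_below_zero vanishes_below_add)

lemma vanishes_below_prod:
  assumes "finite A" "\<And>i. i \<in> A \<Longrightarrow> vanishes_below 1 (f i)"
  shows "vanishes_below (card A) (prod f A)"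
  using assms
proof (induction A rule: finite_induct)
  case (insert i A)
  then have "vanishes_below (1 + card A) (f i * prod f A)"
    by (intro vanishes_below_mult) auto
  then show ?case using insert.hyps by simp
qed (simp add: vanishes_below_0)

lemma vanishes_below_power_diff_1:
  assumes "vanishes_below 1 (x - 1)" shows "vanishes_below 1 (x ^ n - 1)"
proof (induction n)
  case (Suc n)
  have "x ^ Suc n - 1 = x * (x ^ n - 1) + (x - 1)" by (simp add: algebra_simps)
  then show ?case
    using vanishes_below_add[OF vanishes_below_mult_left[OF Suc] assms] by metis
qed (simp add: vanishes_below_zero)

lemma vanishes_below_nonempty_set_species: "vanishes_below 1 (virt_of nonempty_set_species)"
proof -
  have "virt_of nonempty_set_species =
      virt_of_spe (spe_of nonempty_set_species) - virt_of_spe (0 :: 'a spe)"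
    unfolding virt_of_def by transfer simp
  then show ?thesis
    unfolding vanishes_below_def
    by (intro exI[of _ "spe_of nonempty_set_species"] exI[of _ 0])
      (auto simp: spe_part_0 spe_part_eq_0_iff)
qed


section \<open>Colourings with prescribed sets of colours\<close>

text \<open>
  A colouring is stored as its family of colour classes \<open>g c\<close> rather than as a function on labels:
  transport is then the direct image, and no default value outside \<open>U\<close> is needed.  The set of
  colours that occur has to be a member of \<open>\<T>\<close>.
\<close>

definition is_colouring :: "'c set set \<Rightarrow> 'a set \<Rightarrow> ('c \<Rightarrow> 'a set) \<Rightarrow> bool" where
  "is_colouring \<T> U g \<longleftrightarrow>
     {c. g c \<noteq> {}} \<in> \<T> \<and> (\<Union>c. g c) = U \<and> (\<forall>c d. c \<noteq> d \<longrightarrow> g c \<inter> g d = {})"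

definition colourings :: "'c set set \<Rightarrow> ('a, 'c \<Rightarrow> 'a set) species" where
  "colourings \<T> = mk_species (\<lambda>U. {g. is_colouring \<T> U g}) (\<lambda>U \<sigma> g c. \<sigma> ` g c)"

lemma is_colouring_image:
  assumes "is_colouring \<T> U g" "inj_on \<sigma> U"
  shows "is_colouring \<T> (\<sigma> ` U) (\<lambda>c. \<sigma> ` g c)"
proof -
  have sub: "g c \<subseteq> U" for c using assms(1) by (auto simp: is_colouring_def)
  have "\<sigma> ` g c \<inter> \<sigma> ` g d = {}" if "c \<noteq> d" for c d
    using that assms(1) inj_on_image_Int[OF assms(2) sub sub, of c d] by (simp add: is_colouring_def)
  moreover have "(\<Union>c. \<sigma> ` g c) = \<sigma> ` U"
    using assms(1) by (simp add: is_colouring_def flip: image_UN)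
  ultimately show ?thesis
    using assms(1) by (simp add: is_colouring_def)
qed

lemma colourings:
  assumes "finite (\<Union>\<T>)"
  shows "structs (colourings \<T>) = (\<lambda>U. {g. is_colouring \<T> U g})"
    "transport (colourings \<T>) = (\<lambda>U \<sigma> g c. \<sigma> ` g c)"
proof -
  have *: "species_functor (\<lambda>U. {g. is_colouring \<T> U g}) (\<lambda>U \<sigma> g c. \<sigma> ` g c)"
  proof (rule species_functorI, goal_cases)
    case (1 U)
    have "{g. is_colouring \<T> U g} \<subseteq>
        {g. \<forall>c. (c \<in> \<Union>\<T> \<longrightarrow> g c \<in> Pow U) \<and> (c \<notin> \<Union>\<T> \<longrightarrow> g c = {})}"
      by (auto simp: is_colouring_def)
    then show ?case
      by (rule finite_subset) (use assms 1 in \<open>intro finite_set_of_finite_funs finite_Pow_iff[THEN iffD2]\<close>)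
  next
    case (2 U V \<sigma> g)
    then show ?case using is_colouring_image[of \<T> U g \<sigma>] by (auto simp: bij_betw_def)
  next
    case (3 U V \<sigma> \<sigma>' g)
    then have "g c \<subseteq> U" for c by (auto simp: is_colouring_def)
    then show ?case using 3(3) by (intro ext image_cong refl) auto
  qed (simp_all add: image_comp)
  show "structs (colourings \<T>) = (\<lambda>U. {g. is_colouring \<T> U g})"
    "transport (colourings \<T>) = (\<lambda>U \<sigma> g c. \<sigma> ` g c)"
    unfolding colourings_def by (rule mk_species[OF *])+
qed

lemma virt_of_colourings_empty: "virt_of (colourings {}) = 0"
  unfolding virt_of_zero[symmetric] virt_of_eq_iff
  by (rule species_isoI[of "\<lambda>_ _. ()"]) (simp_all add: colourings is_colouring_def bij_betw_def)

lemma virt_of_colourings_insert: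
  assumes fin: "finite T" "finite (\<Union>\<T>)" and new: "T \<notin> \<T>"
  shows "virt_of (colourings (insert T \<T>)) = virt_of (colourings {T}) + (virt_of (colourings \<T>) :: 'b virt)"
proof -
  have insert: "is_colouring (insert T \<T>) U g \<longleftrightarrow> is_colouring {T} U g \<or> is_colouring \<T> U g"
    and supp: "is_colouring {T} U g \<Longrightarrow> {c. g c \<noteq> {}} = T" "is_colouring \<T> U g \<Longrightarrow> {c. g c \<noteq> {}} \<noteq> T"
    for U :: "'b set" and g
    using new by (auto simp only: is_colouring_def)
  have "species_iso (colourings (insert T \<T>)) (species_sum (colourings {T}) (colourings \<T> :: ('b, _) species))"
  proof (rule species_iso_witness[of _ "\<lambda>_ g. if {c. g c \<noteq> {}} = T then Inl g else Inr g"
        _ "\<lambda>_. case_sum id id"], goal_cases)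
    case (1 U g)
    then have "is_colouring {T} U g \<or> is_colouring \<T> U g"
      using fin insert[of U g] by (simp add: colourings)
    then show ?case
    proof
      assume g: "is_colouring {T} U g"
      show ?thesis using fin g by (simp add: colourings supp(1)[OF g] InlI)
    next
      assume g: "is_colouring \<T> U g"
      show ?thesis using fin g by (simp add: colourings supp(2)[OF g] InrI)
    qed
  next
    case (2 U t)
    then consider g where "t = Inl g" "is_colouring {T} U g" | g where "t = Inr g" "is_colouring \<T> U g"
      using fin by (auto simp: colourings)
    then show ?case
      using fin by cases (simp_all add: colourings insert supp(1)[of U] supp(2)[of U])
  next
    case (3 U V \<sigma> g)
    then show ?case using fin by (simp add: colourings)
  qed
  then show ?thesis
    by (simp only: virt_of_sum[symmetric] virt_of_eq_iff)
qed

lemma virt_of_colourings_no_colour: "virt_of (colourings {{}}) = 1"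
  unfolding virt_of_one[symmetric] virt_of_eq_iff
  by (rule species_iso_witness[of _ "\<lambda>_ _. ()" _ "\<lambda>_ _ _. {}"])
    (auto simp: colourings is_colouring_def split: if_splits)

text \<open>
  Split off the class of the colour \<open>c\<close>, a nonempty set.
\<close>

lemma virt_of_colourings_insert_colour:
  fixes c :: 'c
  assumes T: "finite T" "c \<notin> T"
  shows "virt_of (colourings {insert c T}) = virt_of nonempty_set_species * virt_of (colourings {T})"
proof -
  have "species_iso (colourings {insert c T}) (species_prod nonempty_set_species (colourings {T}))"
  proof (rule species_iso_witness[of _ "\<lambda>U g. ((g c, U - g c), ((), g(c := {})))"
        _ "\<lambda>_ ((A, _), (_, g)). g(c := A)"], goal_cases)
    case (1 U g)
    then have g: "{d. g d \<noteq> {}} = insert c T" "(\<Union>d. g d) = U" "\<And>d e. d \<noteq> e \<Longrightarrow> g d \<inter> g e = {}"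
      using T by (auto simp: colourings is_colouring_def)
    have "{d. (g(c := {})) d \<noteq> {}} = T"
      using g(1) T(2) by auto
    moreover have "(\<Union>d. (g(c := {})) d) = U - g c"
    proof (intro equalityI subsetI)
      fix x assume "x \<in> (\<Union>d. (g(c := {})) d)"
      then obtain d where "d \<noteq> c" "x \<in> g d" by (auto split: if_splits)
      then show "x \<in> U - g c" using g(2,3) by fastforce
    next
      fix x assume "x \<in> U - g c"
      then obtain d where "x \<in> g d" "d \<noteq> c" using g(2) by auto
      then show "x \<in> (\<Union>d. (g(c := {})) d)" by (auto intro!: exI[of _ d])
    qed
    ultimately have "is_colouring {T} (U - g c) (g(c := {}))"
      using g(3) by (simp add: is_colouring_def)
    moreover have "g c \<noteq> {}" "g c \<subseteq> U" using g by blast+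
    ultimately show ?case using T by (simp add: colourings Un_absorb1)
  next
    case (2 U t)
    then obtain A B g where t: "t = ((A, B), ((), g))" "U = A \<union> B" "A \<inter> B = {}" "A \<noteq> {}"
      and "is_colouring {T} B g"
      using T by (auto simp: colourings split: if_splits)
    then have g: "{d. g d \<noteq> {}} = T" "(\<Union>d. g d) = B" "\<And>d e. d \<noteq> e \<Longrightarrow> g d \<inter> g e = {}"
      by (auto simp: is_colouring_def)
    have gc: "g c = {}" using g(1) T(2) by blast
    have sub: "g d \<subseteq> B" for d using g(2) by blast
    have "{d. (g(c := A)) d \<noteq> {}} = insert c T"
      using g(1) t(4) by auto
    moreover have "(\<Union>d. (g(c := A)) d) = A \<union> B"
    proof (intro equalityI subsetI)
      fix x assume "x \<in> A \<union> B"
      then consider "x \<in> A" | d where "x \<in> g d" "d \<noteq> c" using g(2) gc by blast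
      then show "x \<in> (\<Union>d. (g(c := A)) d)"
        by cases (auto intro: exI[of _ c])
    qed (use g(2) in \<open>auto split: if_splits\<close>)
    moreover have "(g(c := A)) d \<inter> (g(c := A)) e = {}" if "d \<noteq> e" for d e
      using g(3)[OF that] that sub[of d] sub[of e] t(3) by auto
    ultimately have "is_colouring {insert c T} U (g(c := A))"
      using t(2) by (simp add: is_colouring_def)
    moreover have "g(c := {}) = g" using gc by (rule fun_upd_idem)
    moreover have "A \<union> B - A = B" using t(3) by blast
    ultimately show ?case using T t by (simp add: colourings)
  next
    case (3 U V \<sigma> g)
    then have "g c \<subseteq> U" using T by (auto simp: colourings is_colouring_def)
    then have "\<sigma> ` (U - g c) = V - \<sigma> ` g c"
      using 3(3) inj_on_image_set_diff[of \<sigma> U U "g c"] by (auto simp: bij_betw_def)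
    then show ?case using T by (simp add: colourings fun_eq_iff)
  qed
  then show ?thesis
    by (simp only: virt_of_prod[symmetric] virt_of_eq_iff)
qed

lemma virt_of_colourings_colours:
  assumes "finite T"
  shows "virt_of (colourings {T}) = virt_of nonempty_set_species ^ card T"
  using assms
  by (induction T rule: finite_induct)
    (simp_all add: virt_of_colourings_no_colour virt_of_colourings_insert_colour)

text \<open>
  The set of colours in use does not change under transport, so the species is the sum of its parts with a
  fixed set of colours.
\<close>

lemma virt_of_colourings:
  assumes "finite \<T>" "\<And>T. T \<in> \<T> \<Longrightarrow> finite T"
  shows "(virt_of (colourings \<T>) :: 'a virt) = (\<Sum>T\<in>\<T>. virt_of nonempty_set_species ^ card T)"
  using assms
proof (induction \<T> rule: finite_induct)
  case (insert T \<T>)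
  then have "finite T" "finite (\<Union>\<T>)" by auto
  then have "virt_of (colourings (insert T \<T>)) =
      virt_of (colourings {T}) + (virt_of (colourings \<T>) :: 'a virt)"
    using insert.hyps(2) by (rule virt_of_colourings_insert)
  then show ?case
    using insert \<open>finite T\<close> by (simp add: virt_of_colourings_colours)
qed (simp add: virt_of_colourings_empty)


section \<open>Canonical representation of interval orders\<close>

lemma two_plus_two_free_iff:
  assumes P: "poset_on U P"
  shows "two_plus_two_free U P \<longleftrightarrow>
     (\<forall>a b c d. (a, b) \<in> P \<longrightarrow> (c, d) \<in> P \<longrightarrow> (a, d) \<in> P \<or> (c, b) \<in> P)"
    (is "_ \<longleftrightarrow> ?r")
proof
  have sub: "P \<subseteq> U \<times> U" and irr: "\<And>x. (x, x) \<notin> P"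
    and tr: "\<And>x y z. (x, y) \<in> P \<Longrightarrow> (y, z) \<in> P \<Longrightarrow> (x, z) \<in> P"
    using P by (auto simp: poset_on_def irrefl_def dest: transD)
  assume free: "two_plus_two_free U P"
  show ?r
  proof (intro allI impI, rule ccontr)
    fix a b c d assume ab: "(a, b) \<in> P" and cd: "(c, d) \<in> P" and "\<not> ((a, d) \<in> P \<or> (c, b) \<in> P)"
    then have n: "(a, d) \<notin> P" "(c, b) \<notin> P" by auto
    have dist: "a \<noteq> b" "c \<noteq> d" "a \<noteq> c" "b \<noteq> d" "a \<noteq> d" "b \<noteq> c"
      using ab cd n irr tr by blast+
    have n': "(b, a) \<notin> P" "(d, c) \<notin> P" "(a, c) \<notin> P" "(c, a) \<notin> P" "(b, d) \<notin> P" "(d, b) \<notin> P"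
        "(b, c) \<notin> P" "(d, a) \<notin> P"
      using ab cd n irr tr by blast+
    \<comment> \<open>All other pairs are unrelated: a relation between the two chains would give
      \<open>(a, d)\<close> or \<open>(c, b)\<close> by transitivity.\<close>
    let ?f = "\<lambda>x. if x = a then 0 else if x = b then 1 else if x = c then 2 else 3 :: nat"
    have "poset_iso {a, b, c, d} (P \<inter> {a, b, c, d} \<times> {a, b, c, d}) {0, 1, 2, 3} two_plus_two"
      unfolding poset_iso_def
    proof (intro exI[of _ ?f] conjI)
      show "bij_betw ?f {a, b, c, d} {0, 1, 2, 3}"
        using dist by (auto simp: bij_betw_def)
      show "\<forall>x\<in>{a, b, c, d}. \<forall>y\<in>{a, b, c, d}.
          (x, y) \<in> P \<inter> {a, b, c, d} \<times> {a, b, c, d} \<longleftrightarrow> (?f x, ?f y) \<in> two_plus_two"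
        using dist dist[symmetric] ab cd n n' irr by (simp add: two_plus_two_def)
    qed
    moreover have "{a, b, c, d} \<subseteq> U" using ab cd sub by auto
    ultimately show False using free unfolding two_plus_two_free_def by blast
  qed
next
  assume r: ?r
  show "two_plus_two_free U P"
    unfolding two_plus_two_free_def
  proof (rule notI, elim exE conjE)
    fix W assume "poset_iso W (P \<inter> W \<times> W) {0, 1, 2, 3} two_plus_two"
    then obtain f where "bij_betw f W {0, 1, 2, 3}"
      and iff: "\<forall>x\<in>W. \<forall>y\<in>W. (x, y) \<in> P \<inter> W \<times> W \<longleftrightarrow> (f x, f y) \<in> two_plus_two"
      unfolding poset_iso_def by (elim exE conjE)
    then have f: "f ` W = {0, 1, 2, 3}" by (simp add: bij_betw_def)
    have "0 \<in> f ` W" "1 \<in> f ` W" "2 \<in> f ` W" "3 \<in> f ` W" by (simp_all add: f)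
    then obtain a b c d where W: "a \<in> W" "b \<in> W" "c \<in> W" "d \<in> W"
      and val: "0 = f a" "1 = f b" "2 = f c" "3 = f d"
      by (elim imageE)
    have "(a, b) \<in> P" "(c, d) \<in> P" "(a, d) \<notin> P" "(c, b) \<notin> P"
      using iff[rule_format, OF W(1,2)] iff[rule_format, OF W(3,4)] iff[rule_format, OF W(1,4)]
        iff[rule_format, OF W(3,2)] W
      by (simp_all add: val[symmetric] two_plus_two_def)
    with r show False by blast
  qed
qed

definition down_set :: "('a \<times> 'a) set \<Rightarrow> 'a \<Rightarrow> 'a set" where
  "down_set P y = {x. (x, y) \<in> P}"

text \<open>
  The canonical end points.  The down-sets of an interval order form a chain; \<open>left_end\<close> is the
  position of the down-set of \<open>x\<close> in it, and \<open>right_end\<close> is the position of the last down-set that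
  avoids \<open>x\<close>.  The subtraction does not truncate for \<open>x \<in> U\<close>, because the down-set of \<open>x\<close> itself
  avoids \<open>x\<close>.
\<close>

definition left_end :: "'a set \<Rightarrow> ('a \<times> 'a) set \<Rightarrow> 'a \<Rightarrow> nat" where
  "left_end U P x = card {D \<in> down_set P ` U. D \<subset> down_set P x}"

definition right_end :: "'a set \<Rightarrow> ('a \<times> 'a) set \<Rightarrow> 'a \<Rightarrow> nat" where
  "right_end U P x = card {D \<in> down_set P ` U. x \<notin> D} - 1"

text \<open>
  Representations by intervals that are minimal: every number below \<open>m\<close> is a left end and a right
  end.
\<close>

definition interval_rep :: "nat \<Rightarrow> 'a set \<Rightarrow> ('a \<times> 'a) set \<Rightarrow> ('a \<Rightarrow> nat) \<Rightarrow> ('a \<Rightarrow> nat) \<Rightarrow> bool" where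
  "interval_rep m U P l r \<longleftrightarrow> P = {(x, y). x \<in> U \<and> y \<in> U \<and> r x < l y} \<and>
     (\<forall>x\<in>U. l x \<le> r x) \<and> l ` U = {..<m} \<and> r ` U = {..<m}"

lemma interval_rep_imp_interval_order:
  assumes "interval_rep m U P l r"
  shows "poset_on U P" "two_plus_two_free U P"
proof -
  have P: "P = {(x, y). x \<in> U \<and> y \<in> U \<and> r x < l y}" and le: "\<And>x. x \<in> U \<Longrightarrow> l x \<le> r x"
    using assms by (auto simp: interval_rep_def)
  show *: "poset_on U P"
    unfolding poset_on_def
  proof (intro conjI)
    show "P \<subseteq> U \<times> U" using P by auto
    show "irrefl P" using P le by (fastforce simp: irrefl_def)
    show "trans P" using P le by (fastforce intro: transI)
  qed
  show "two_plus_two_free U P"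
    unfolding two_plus_two_free_iff[OF *] unfolding P by auto
qed

text \<open>
  The down-set of \<open>y\<close> is \<open>D (l y)\<close>, where \<open>D j = {x \<in> U. r x < j}\<close>.  Every \<open>i < m\<close> is a right end, so
  the sets \<open>D j\<close> for \<open>j < m\<close> are strictly increasing, and every \<open>j < m\<close> is a left end, so they
  are exactly the down-sets.  Hence counting down-sets recovers \<open>l\<close> and \<open>r\<close>.
\<close>

lemma interval_rep_unique:
  assumes "interval_rep m U P l r" and x: "x \<in> U"
  shows "left_end U P x = l x" "right_end U P x = r x"
proof -
  have P: "P = {(x, y). x \<in> U \<and> y \<in> U \<and> r x < l y}"
    and im: "l ` U = {..<m}" "r ` U = {..<m}"
    using assms by (auto simp: interval_rep_def)
  define D where "D j = {x \<in> U. r x < j}" for j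
  have down: "down_set P y = D (l y)" if "y \<in> U" for y
    using that by (auto simp: down_set_def D_def P)
  have downs: "down_set P ` U = D ` {..<m}"
    unfolding im(1)[symmetric] image_image using down by (intro image_cong) auto
  have less: "D i \<subset> D j \<longleftrightarrow> i < j" if "i < m" "j < m" for i j
  proof -
    have "i \<in> r ` U" using that im(2) by simp
    then obtain z where z: "z \<in> U" "i = r z" by (elim imageE)
    show ?thesis
    proof
      assume "i < j"
      then have "z \<in> D j" "z \<notin> D i" using z by (simp_all add: D_def)
      moreover have "D i \<subseteq> D j" using \<open>i < j\<close> by (auto simp: D_def)
      ultimately show "D i \<subset> D j" by blast
    next
      assume ij: "D i \<subset> D j"
      show "i < j"
      proof (rule ccontr)
        assume "\<not> i < j"
        then have "D j \<subseteq> D i" by (auto simp: D_def)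
        with ij show False by blast
      qed
    qed
  qed
  have inj: "inj_on D {..<m}"
    by (rule inj_onI) (metis less lessThan_iff linorder_neqE_nat psubset_eq)
  have lx: "l x < m" and rx: "r x < m" using im x by auto
  have "{j. j < m \<and> D j \<subset> D (l x)} = {..<l x}"
    using less[OF _ lx] order.strict_trans[OF _ lx]
    by (intro set_eqI) (simp only: mem_Collect_eq lessThan_iff, metis)
  moreover have "{C \<in> D ` {..<m}. C \<subset> D (l x)} = D ` {j. j < m \<and> D j \<subset> D (l x)}"
    by blast
  ultimately have "{C \<in> D ` {..<m}. C \<subset> D (l x)} = D ` {..<l x}"
    by simp
  moreover have "card (D ` {..<l x}) = l x"
    using lx by (subst card_image[OF inj_on_subset[OF inj]]) auto
  ultimately show "left_end U P x = l x"
    by (simp add: left_end_def downs down[OF x])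
  have "{C \<in> D ` {..<m}. x \<notin> C} = D ` {..r x}"
    using rx x by (auto simp: D_def)
  moreover have "card (D ` {..r x}) = Suc (r x)"
    using rx by (subst card_image[OF inj_on_subset[OF inj]]) auto
  ultimately show "right_end U P x = r x"
    by (simp add: right_end_def downs)
qed

text \<open>
  The down-sets form a chain: elements of \<open>C - D\<close> and \<open>D - C\<close>, for down-sets \<open>C\<close> and \<open>D\<close>, would be
  the bottoms of a \<open>2+2\<close>.  Hence the rank \<open>left_end\<close> takes every value below the
  number of down-sets, and the down-sets that avoid \<open>x\<close> are an initial segment of the chain.
\<close>

lemma interval_rep_exists:
  assumes U: "finite U" and P: "poset_on U P" and free: "two_plus_two_free U P"
  shows "interval_rep (card (down_set P ` U)) U P (left_end U P) (right_end U P)"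
proof -
  define \<D> where "\<D> = down_set P ` U"
  define m where "m = card \<D>"
  define rank where "rank D = card {C \<in> \<D>. C \<subset> D}" for D
  define N where "N x = {D \<in> \<D>. x \<notin> D}" for x
  have sub: "P \<subseteq> U \<times> U" and irr: "\<And>x. (x, x) \<notin> P"
    using P by (auto simp: poset_on_def irrefl_def)
  have fin: "finite \<D>" using U by (simp add: \<D>_def)
  have chain: "C \<subseteq> D \<or> D \<subseteq> C" if "C \<in> \<D>" "D \<in> \<D>" for C D
  proof (rule ccontr)
    assume "\<not> ?thesis"
    then obtain a c where "a \<in> C" "a \<notin> D" "c \<in> D" "c \<notin> C" by blast
    with that free show False
      unfolding two_plus_two_free_iff[OF P] \<D>_def down_set_def by blast
  qed
  have rank_less: "rank C < rank D" if "C \<in> \<D>" "C \<subset> D" for C D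
    unfolding rank_def using that fin by (intro psubset_card_mono) auto
  have rank_inj: "inj_on rank \<D>"
  proof (rule inj_onI)
    fix C D assume "C \<in> \<D>" "D \<in> \<D>" "rank C = rank D"
    then show "C = D" using chain[of C D] rank_less[of C D] rank_less[of D C] by auto
  qed
  have "rank D < m" if "D \<in> \<D>" for D
    unfolding rank_def m_def using that fin by (intro psubset_card_mono) auto
  then have rank_im: "rank ` \<D> = {..<m}"
    by (intro card_subset_eq) (auto simp: card_image[OF rank_inj] m_def)
  have left: "left_end U P x = rank (down_set P x)" for x
    by (simp add: left_end_def rank_def \<D>_def)
  have left_im: "left_end U P ` U = {..<m}"
    unfolding rank_im[symmetric] \<D>_def image_image left by (rule refl)
  have below: "rank D < card (N x)" if "D \<in> \<D>" "x \<notin> D" for D x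
    unfolding rank_def N_def using that fin by (intro psubset_card_mono) auto
  have above: "card (N x) \<le> rank D" if "D \<in> \<D>" "x \<in> D" for D x
    unfolding rank_def N_def using that fin chain by (intro card_mono) auto
  have right: "card (N x) = Suc (right_end U P x)" if "x \<in> U" for x
    using below[of "down_set P x" x] that irr
    by (simp add: right_end_def N_def \<D>_def down_set_def)
  have iff: "(x, y) \<in> P \<longleftrightarrow> right_end U P x < left_end U P y" if "x \<in> U" "y \<in> U" for x y
    using below[of "down_set P y" x] above[of "down_set P y" x] right[OF that(1)] that(2)
    by (fastforce simp: left \<D>_def down_set_def)
  have le: "left_end U P x \<le> right_end U P x" if "x \<in> U" for x
    using iff[OF that that] irr by (simp add: not_less)
  have right_less: "right_end U P x < m" if "x \<in> U" for x
    using right[OF that] card_mono[OF fin, of "N x"] by (auto simp: m_def N_def)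
  have "\<exists>x\<in>U. right_end U P x = j" if j: "j < m" for j
  proof -
    obtain z where z: "z \<in> U" "left_end U P z = j" using left_im j by (metis imageE lessThan_iff)
    show ?thesis
    \<comment> \<open>An element of the next down-set that is not in the one of rank \<open>j\<close> has right end \<open>j\<close>; above the
      last down-set any element with left end \<open>j\<close> serves.\<close>
    proof (cases "Suc j < m")
      case True
      then obtain y where y: "y \<in> U" "left_end U P y = Suc j" using left_im by (metis imageE lessThan_iff)
      have "\<not> down_set P y \<subset> down_set P z" "down_set P y \<noteq> down_set P z"
        using rank_less[of "down_set P y" "down_set P z"] y z by (auto simp: left \<D>_def)
      then obtain x where "(x, y) \<in> P" "(x, z) \<notin> P"
        by (auto simp: down_set_def)
      moreover from this have x: "x \<in> U" using sub by auto
      ultimately have "right_end U P x = j"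
        using iff[OF x y(1)] iff[OF x z(1)] y z by simp
      with x show ?thesis by blast
    next
      case False
      then have "right_end U P z = j"
        using le[OF z(1)] right_less[OF z(1)] z(2) j by simp
      with z show ?thesis by blast
    qed
  qed
  then have right_im: "right_end U P ` U = {..<m}"
    using right_less by fastforce
  have "P = {(x, y). x \<in> U \<and> y \<in> U \<and> right_end U P x < left_end U P y}"
    using iff sub by auto
  then show ?thesis
    using le left_im right_im unfolding interval_rep_def m_def \<D>_def by blast
qed


section \<open>Interval orders as Fishburn colourings\<close>

text \<open>
  The right end is the row and the left end is the column: then \<open>l x \<le> r x\<close> puts the colours into
  the triangle of \<open>fishburn\<close>.
\<close>

definition colour_blocks :: "'a set \<Rightarrow> ('a \<Rightarrow> nat) \<Rightarrow> ('a \<Rightarrow> nat) \<Rightarrow> nat \<times> nat \<Rightarrow> 'a set" where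
  "colour_blocks U l r c = {x \<in> U. (r x, l x) = c}"

definition colour_order :: "(nat \<times> nat \<Rightarrow> 'a set) \<Rightarrow> ('a \<times> 'a) set" where
  "colour_order g = {(x, y). \<exists>c d. x \<in> g c \<and> y \<in> g d \<and> fst c < snd d}"

lemma interval_rep_imp_colouring:
  assumes "interval_rep m U P l r"
  shows "is_colouring (fishburn m) U (colour_blocks U l r)" "colour_order (colour_blocks U l r) = P"
proof -
  have P: "P = {(x, y). x \<in> U \<and> y \<in> U \<and> r x < l y}" and le: "\<And>x. x \<in> U \<Longrightarrow> l x \<le> r x"
    and im: "l ` U = {..<m}" "r ` U = {..<m}"
    using assms by (auto simp: interval_rep_def)
  have supp: "{c. colour_blocks U l r c \<noteq> {}} = (\<lambda>x. (r x, l x)) ` U"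
    by (auto simp: colour_blocks_def)
  have "(\<lambda>x. (r x, l x)) ` U \<in> fishburn m"
    using le im by (auto simp: fishburn_def image_image)
  then show "is_colouring (fishburn m) U (colour_blocks U l r)"
    unfolding is_colouring_def supp by (auto simp: colour_blocks_def)
  show "colour_order (colour_blocks U l r) = P"
    unfolding P by (auto simp: colour_order_def colour_blocks_def)
qed

lemma colouring_imp_interval_rep:
  assumes "is_colouring (fishburn m) U g"
  obtains l r where "interval_rep m U (colour_order g) l r" "colour_blocks U l r = g"
proof -
  have supp: "{c. g c \<noteq> {}} \<in> fishburn m" and U: "(\<Union>c. g c) = U"
    and disj: "\<And>c d. c \<noteq> d \<Longrightarrow> g c \<inter> g d = {}"
    using assms unfolding is_colouring_def by blast+
  define col where "col x = (SOME c. x \<in> g c)" for x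
  have col: "x \<in> g (col x)" if "x \<in> U" for x
    using that unfolding U[symmetric] col_def by (auto intro: someI)
  have mem: "x \<in> g c \<longleftrightarrow> x \<in> U \<and> col x = c" for x c
    using col[of x] disj[of c "col x"] U by blast
  have "{c. g c \<noteq> {}} = col ` U"
    unfolding image_def ex_in_conv[symmetric] mem by blast
  then have fish: "col ` U \<subseteq> Sigma {..<m} (\<lambda>i. {..i})" "fst ` col ` U = {..<m}" "snd ` col ` U = {..<m}"
    using supp by (simp_all add: fishburn_def)
  have "snd (col x) \<le> fst (col x)" if "x \<in> U" for x
    using fish(1) that by (cases "col x") (auto simp: image_subset_iff)
  then have "interval_rep m U (colour_order g) (snd \<circ> col) (fst \<circ> col)"
    unfolding interval_rep_def using fish(2,3) by (auto simp: colour_order_def mem image_comp)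
  moreover have "colour_blocks U (snd \<circ> col) (fst \<circ> col) = g"
    by (rule ext) (auto simp: colour_blocks_def mem)
  ultimately show thesis by (rule that)
qed

text \<open>
  A representation on \<open>N\<close> labels uses \<open>m \<le> N\<close> end points, since each of them is the left end of some
  label; this is why the finitely many supports with \<open>m \<le> N\<close> suffice.  The map from colourings to
  orders is the one whose naturality is evident; naturality of its inverse, which counts down-sets, follows.
\<close>

lemma interval_orders_iso_colourings:
  "species_iso (species_part N (colourings (\<Union>m\<le>N. fishburn m))) (species_part N interval_orders)"
proof -
  have fin: "finite (\<Union>(\<Union>m\<le>N. fishburn m))"
    using finite_fishburn by blast
  have iff: "is_colouring (\<Union>m\<le>N. fishburn m) U g \<longleftrightarrow> (\<exists>m\<le>N. is_colouring (fishburn m) U g)"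
    for U :: "'a set" and g
    by (auto simp: is_colouring_def)
  show ?thesis
  proof (rule species_iso_witness[of _ "\<lambda>_. colour_order"
        _ "\<lambda>U P. colour_blocks U (left_end U P) (right_end U P)"], goal_cases)
    case (1 U g)
    then have card: "card U = N" and "\<exists>m\<le>N. is_colouring (fishburn m) U g"
      using fin iff[of U g] by (simp_all add: colourings split: if_splits)
    then obtain m where "is_colouring (fishburn m) U g" by blast
    then obtain l r where rep: "interval_rep m U (colour_order g) l r" and g: "colour_blocks U l r = g"
      by (rule colouring_imp_interval_rep)
    have "colour_blocks U (left_end U (colour_order g)) (right_end U (colour_order g)) =
        colour_blocks U l r"
      by (rule ext) (use interval_rep_unique[OF rep] in \<open>auto simp: colour_blocks_def\<close>)
    then have "colour_blocks U (left_end U (colour_order g)) (right_end U (colour_order g)) = g"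
      unfolding g .
    then show ?case
      using card interval_rep_imp_interval_order[OF rep] by simp
  next
    case (2 U P)
    then have card: "card U = N" and "poset_on U P" "two_plus_two_free U P"
      by (simp_all split: if_splits)
    then have rep: "interval_rep (card (down_set P ` U)) U P (left_end U P) (right_end U P)"
      using 2(1) by (intro interval_rep_exists)
    moreover have "card (down_set P ` U) \<le> N"
      using card_image_le[OF 2(1)] card by blast
    ultimately show ?case
      using card fin iff interval_rep_imp_colouring[OF rep] by (auto simp: colourings)
  next
    case (3 U V \<sigma> g)
    have "colour_order (\<lambda>c. \<sigma> ` g c) = map_prod \<sigma> \<sigma> ` colour_order g"
      by (force simp: colour_order_def)
    then show ?case using fin by (simp add: colourings)
  qed
qed

lemma virt_part_interval_orders:
  "virt_part N (virt_of interval_orders :: 'a virt) =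
     virt_part N (\<Sum>m\<le>N. \<Sum>T\<in>fishburn m. virt_of nonempty_set_species ^ card T)"
proof -
  have "virt_of (colourings (\<Union>m\<le>N. fishburn m)) =
      (\<Sum>T\<in>(\<Union>m\<le>N. fishburn m). virt_of nonempty_set_species ^ card T :: 'a virt)"
    using finite_fishburn by (intro virt_of_colourings) auto
  also have "\<dots> = (\<Sum>m\<le>N. \<Sum>T\<in>fishburn m. virt_of nonempty_set_species ^ card T)"
    using finite_fishburn(1) by (intro sum.UNION_disjoint) (auto simp: fishburn_def)
  finally have sum: "virt_of (colourings (\<Union>m\<le>N. fishburn m)) =
      (\<Sum>m\<le>N. \<Sum>T\<in>fishburn m. virt_of nonempty_set_species ^ card T :: 'a virt)" .
  have "virt_of (species_part N (colourings (\<Union>m\<le>N. fishburn m))) =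
      (virt_of (species_part N interval_orders) :: 'a virt)"
    unfolding virt_of_eq_iff by (rule interval_orders_iso_colourings)
  then show ?thesis
    by (simp only: virt_part_virt_of[symmetric] sum)
qed

text \<open>
  Each of the \<open>m\<close> rows contributes a factor that vanishes on the empty set.
\<close>

lemma vanishes_below_sieve:
  assumes "vanishes_below 1 (E - 1)" shows "vanishes_below m (sieve E m h)"
  unfolding sieve_def
proof (rule vanishes_below_sum)
  fix S
  have "vanishes_below m (\<Prod>i<m. E ^ card ({..i} \<inter> S) - 1)"
    using vanishes_below_prod[of "{..<m}" "\<lambda>i. E ^ card ({..i} \<inter> S) - 1"]
      vanishes_below_power_diff_1[OF assms] by simp
  then show "vanishes_below m ((-1) ^ (m - card S) * (\<Prod>i<m. E ^ card ({..i} \<inter> S) - 1) * h (card S))"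
    by (metis vanishes_below_mult_left mult.commute)
qed

section \<open>The species of interval orders as a series\<close>

theorem theorem1p1:
  shows "(\<lambda>m. (-1) ^ m * (\<Prod>i = 1..m. (E_inv ^ i - 1))) virt_sums (virt_of interval_orders :: 'a virt)"
proof -
  define Y :: "'a virt" where "Y = virt_of nonempty_set_species"
  define p :: "nat \<Rightarrow> 'a virt" where "p m = (\<Prod>i=1..m. 1 - E_inv ^ i)" for m
  have E: "(virt_of set_species :: 'a virt) = 1 + Y"
    by (metis Y_def set_species_decomp virt_of_eq_iff virt_of_sum virt_of_one)
  have q: "(1 + Y) * E_inv = 1"
    using E_inv[where ?'a = 'a] unfolding E .
  have Y: "vanishes_below 1 (1 + Y - 1)"
    using vanishes_below_nonempty_set_species by (simp add: Y_def)
  have term_eq: "(-1) ^ m * (\<Prod>i=1..m. E_inv ^ i - 1) = p m" for m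
  proof -
    have "(\<Prod>i=1..m. 1 - E_inv ^ i) = (\<Prod>i=1..m. - (E_inv ^ i - 1 :: 'a virt))"
      by simp
    also have "\<dots> = (-1) ^ m * (\<Prod>i=1..m. E_inv ^ i - 1)"
      by (subst prod_uminus) simp
    finally show ?thesis by (simp add: p_def)
  qed
  have "vanishes_below 1 (1 - E_inv ^ i :: 'a virt)" for i
  proof -
    have "(1 + Y) ^ i * E_inv ^ i = 1"
      by (simp add: q flip: power_mult_distrib)
    then have "1 - E_inv ^ i = E_inv ^ i * ((1 + Y) ^ i - 1)"
      by (simp add: algebra_simps)
    then show ?thesis
      using vanishes_below_mult_left[OF vanishes_below_power_diff_1[OF Y]] by metis
  qed
  then have p: "vanishes_below m (p m)" for m
    unfolding p_def using vanishes_below_prod[of "{1..m}" "\<lambda>i. 1 - (E_inv :: 'a virt) ^ i"] by simp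
  have part: "virt_part N (virt_of interval_orders) = (\<Sum>m\<le>N. virt_part N (p m))" for N
  proof -
    obtain G where G: "(\<Sum>m\<le>N. sieve (1 + Y) m (\<lambda>_. 1)) =
        (\<Sum>t\<le>N. \<Prod>k=1..t. 1 - E_inv ^ k) - sieve (1 + Y) (Suc N) G"
      using sum_sieve[OF q] .
    have "virt_part N (virt_of interval_orders :: 'a virt) =
        virt_part N (\<Sum>m\<le>N. sieve (1 + Y) m (\<lambda>_. 1))"
      unfolding virt_part_interval_orders sum_fishburn Y_def ..
    also have "\<dots> = virt_part N (\<Sum>t\<le>N. p t)"
      unfolding G virt_part_diff p_def
      using vanishes_below_virt_part[OF vanishes_below_sieve[OF Y]] by simp
    finally show ?thesis by (simp add: virt_part_sum)
  qed
  show ?thesis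
    unfolding virt_sums_def term_eq
  proof (intro allI conjI)
    fix N
    \<comment> \<open>Beyond the size \<open>N\<close> of the label set, the terms contribute nothing.\<close>
    have sub: "{m. virt_part N (p m) \<noteq> 0} \<subseteq> {..N}"
      using vanishes_below_virt_part[OF p] by (force simp: not_le[symmetric])
    then show "finite {m. virt_part N (p m) \<noteq> 0}"
      by (rule finite_subset) simp
    show "virt_part N (virt_of interval_orders) = (\<Sum>m | virt_part N (p m) \<noteq> 0. virt_part N (p m))"
      unfolding part by (rule sum.mono_neutral_right) (use sub in auto)
  qed
qed


end
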